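(* Let $\mathbf{Q}^{(1)},\dots,\mathbf{Q}^{(n)}\in\mathbb{K}^{m\times m}$ be symmetric matrices, let $\mathcal{S}_{\mathbb K}=\{\mathbf{x}\in\mathbb{K}_{\ge 0}^n : \mathbf{x}_1\mathbf{Q}^{(1)}+\dots+\mathbf{x}_n\mathbf{Q}^{(n)}\succeq 0\}$, and let $Q^{(k)}=\mathrm{sval}(\mathbf{Q}^{(k)})\in\mathbb{T}_\pm^{m\times m}$ for $k\in[n]$. Suppose that: (i) for every $k\in[n]$ and every pair $i\ne j$ in $[m]$ such that $Q^{(k)}_{ii}$ and $Q^{(k)}_{jj}$ both belong to $\mathbb{T}_+$, we have $Q^{(k)}_{ii}+Q^{(k)}_{jj}\neq 2|Q^{(k)}_{ij}|$; (ii) for every subset $\Sigma\subset\{(i,j)\in[m]^2: i<j\}$ and every $\Diamond\in\{\le,\ge\}^{\Sigma^\complement}$, every stratum of the set $\mathcal{S}_{\Sigma,\Diamond}(Q^{(1)},\dots,Q^{(n)})$ is regular. Then $\mathrm{val}(\mathcal{S}_{\mathbb K})$ is determined by the formal tropicalization of the $1\times1$ and $2\times 2$ principal minors, i.e. $\mathrm{val}(\mathcal{S}_{\mathbb K})=\mathcal{S}^{\mathrm{form}}$, where $$\mathcal{S}^{\mathrm{form}}=\{x\in\mathbb{T}^n : \forall i\in[m],\ P^+_{ii}(x)\ge P^-_{ii}(x)\ \text{ and }\ \forall i\neq j,\ P^+_{ij}(x)\ge P^-_{ij}(x)\}.$$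
   Context: $[k]=\{1,\dots,k\}$. $\mathbb{K}$ is the field of formal generalized real Puiseux series: series $\mathbf{x}=\sum_{i\ge 1}c_{\lambda_i}t^{\lambda_i}$ where $(\lambda_i)$ is a strictly decreasing sequence of real numbers that is either finite or unbounded and $c_{\lambda_i}\in\mathbb{R}\setminus\{0\}$, together with the empty series $0$, with the natural addition and multiplication. The leading coefficient is $\mathrm{lc}(\mathbf{x})=c_{\lambda_1}$, $\mathrm{lc}(0)=0$; $\mathbb{K}$ is ordered by $\mathbf{x}\ge\mathbf{y}$ iff $\mathrm{lc}(\mathbf{x}-\mathbf{y})\ge 0$, and is a real closed field. $\mathbb{K}_{\ge0}$ is the set of nonnegative elements. $\succeq 0$ means positive semidefinite over $\mathbb{K}$. The valuation is $\mathrm{val}(\mathbf{x})=\lambda_1$, $\mathrm{val}(0)=-\infty$. $\mathbb{T}=\mathbb{R}\cup\{-\infty\}$ with its usual order and addition ($-\infty$ absorbing). $\mathbb{T}_\pm$ is the set of signed tropical numbers: pairs $(1,a)$ (written $a$; the set of these is $\mathbb{T}_+$), pairs $(-1,a)$ (written $\ominus a$; the set of these is $\mathbb{T}_-$), with $a\in\mathbb{R}$, and $-\infty$ (sign $0$). Modulus: $|a|=|\ominus a|=a$ and $|-\infty|=-\infty$. The signed valuation is $\mathrm{sval}(\mathbf{x})=(\mathrm{sign}(\mathbf{x}),\mathrm{val}(\mathbf{x}))\in\mathbb{T}_\pm$. $\mathrm{val}$ and $\mathrm{sval}$ are applied entrywise. Formal tropicalization: for a polynomial $\mathbf{P}=\sum_{\alpha\in\Lambda}\mathbf{a}_\alpha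 X^\alpha\in\mathbb{K}[X_1,\dots,X_n]$ with $\mathbf{a}_\alpha\neq0$ for all $\alpha\in\Lambda$ (like terms collected), its formal tropicalization $P$ has associated functions on $\mathbb{T}^n$ given by $P^+(x)=\max\{\mathrm{val}(\mathbf{a}_\alpha)+\sum_k\alpha_kx_k : \mathbf{a}_\alpha>0\}$ and $P^-(x)=\max\{\mathrm{val}(\mathbf{a}_\alpha)+\sum_k\alpha_kx_k : \mathbf{a}_\alpha<0\}$, with $\max\emptyset=-\infty$ and $\alpha_kx_k=0$ when $\alpha_k=0$. Let $\mathbf{Q}_{ij}(X)=\sum_k X_k\mathbf{Q}^{(k)}_{ij}$. For $i\in[m]$, $P_{ii}$ is the formal tropicalization of the linear form $\mathbf{Q}_{ii}(X)$; for $i\neq j$, $P_{ij}$ is the formal tropicalization of $\mathbf{Q}_{ii}(X)\mathbf{Q}_{jj}(X)-\mathbf{Q}_{ij}(X)^2$. For $i,j\in[m]$ and $x\in\mathbb{T}^n$, put $Q^+_{ij}(x)=\max\{|Q^{(k)}_{ij}|+x_k : k\in[n],\,Q^{(k)}_{ij}\in\mathbb{T}_+\}$ and $Q^-_{ij}(x)=\max\{|Q^{(k)}_{ij}|+x_k : k\in[n],\,Q^{(k)}_{ij}\in\mathbb{T}_-\}$, with $\max\emptyset=-\infty$. For $\Sigma\subset\{(i,j)\in[m]^2:i<j\}$, $\Sigma^\complement=\{(i,j)\in[m]^2:i<j,(i,j)\notin\Sigma\}$. For $\Diamond\in\{\le,\ge\}^{\Sigma^\complement}$, $\mathcal{S}_{\Sigma,\Diamond}(Q^{(1)},\dots,Q^{(n)})$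 is the set of $x\in\mathbb{T}^n$ such that: for all $i\in[m]$, $Q^+_{ii}(x)\ge Q^-_{ii}(x)$; for all $(i,j)\in\Sigma$, $Q^+_{ii}(x)+Q^+_{jj}(x)\ge 2\max(Q^+_{ij}(x),Q^-_{ij}(x))$; for all $(i,j)\in\Sigma^\complement$, $Q^+_{ij}(x)\mathrel{\Diamond_{(i,j)}}Q^-_{ij}(x)$. The support of $x\in\mathbb{T}^n$ is $\{k: x_k\ne-\infty\}$. For nonempty $K\subset[n]$, the stratum of $S\subset\mathbb{T}^n$ associated with $K$ is the set of $(x_k)_{k\in K}\in\mathbb{R}^K$ for $x\in S$ with support exactly $K$. A set $S\subset\mathbb{R}^p$ is regular if it is closed and $S=\mathrm{cl}(\mathrm{int}(S))$ (Euclidean topology). *)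

theory Defs
  imports "HOL-Analysis.Analysis" "HOL-Library.Poly_Mapping"
begin

section \<open>Generalized real Puiseux series\<close>

text \<open>
  A series is given by its coefficient function \<open>c\<close>, where \<open>c \<lambda>\<close> is the coefficient
  of \<open>t\<close> to the power \<open>\<lambda>\<close>. The exponents with nonzero coefficient form a finite (possibly
  empty) set, or the range of a strictly decreasing sequence that is unbounded.
\<close>

definition puiseux_support :: "real set \<Rightarrow> bool" where
  "puiseux_support S \<longleftrightarrow>
     finite S \<or> (\<exists>l :: nat \<Rightarrow> real. strict_antimono_on UNIV l \<and> \<not> bdd_below (range l) \<and> S = range l)"

lemma le_Max_insert_0:
  fixes S :: "real set"
  assumes "finite {a \<in> S. 0 \<le> a}" "a \<in> S"
  shows "a \<le> Max (insert 0 {a \<in> S. 0 \<le> a})"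
proof (cases "0 \<le> a")
  case True
  then show ?thesis using assms by (intro Max_ge) auto
next
  case False
  moreover have "0 \<le> Max (insert 0 {a \<in> S. 0 \<le> a})" using assms by (intro Max_ge) auto
  ultimately show ?thesis by linarith
qed

lemma puiseux_support_iff: "puiseux_support S \<longleftrightarrow> (\<forall>b. finite {a \<in> S. b \<le> a})"
proof
  assume "puiseux_support S"
  then consider "finite S" | l :: "nat \<Rightarrow> real" where
    "strict_antimono_on UNIV l" "\<not> bdd_below (range l)" "S = range l"
    unfolding puiseux_support_def by auto
  then show "\<forall>b. finite {a \<in> S. b \<le> a}"
  proof cases
    case 1
    then show ?thesis by simp
  next
    case 2
    show ?thesis
    proof
      fix b
      obtain N where N: "l N < b"
        using 2(2) by (force simp: bdd_below_def not_le)
      have "{a \<in> S. b \<le> a} \<subseteq> l ` {..N}"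
      proof
        fix a assume "a \<in> {a \<in> S. b \<le> a}"
        then obtain i where i: "a = l i" "b \<le> l i" using 2(3) by auto
        have "i \<le> N"
        proof (rule ccontr)
          assume "\<not> i \<le> N"
          then have "l i < l N" using 2(1) by (auto simp: monotone_on_def)
          then show False using i N by simp
        qed
        then show "a \<in> l ` {..N}" using i by auto
      qed
      then show "finite {a \<in> S. b \<le> a}" using finite_subset by blast
    qed
  qed
next
  assume fin: "\<forall>b. finite {a \<in> S. b \<le> a}"
  show "puiseux_support S"
  proof (cases "finite S")
    case True
    then show ?thesis by (simp add: puiseux_support_def)
  next
    case False
    have below: "\<exists>a\<in>S. a < x" for x
    proof (rule ccontr)
      assume "\<not> (\<exists>a\<in>S. a < x)"
      then have "{a \<in> S. x \<le> a} = S" by auto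
      then show False using fin[rule_format, of x] False by simp
    qed
    define nxt where "nxt x = Max {a \<in> S. a < x \<and> (SOME z. z \<in> S \<and> z < x) \<le> a}" for x
    have nxt: "nxt x \<in> S \<and> nxt x < x \<and> (\<forall>a\<in>S. a < x \<longrightarrow> a \<le> nxt x)" for x
    proof -
      define z where "z = (SOME z. z \<in> S \<and> z < x)"
      have z: "z \<in> S \<and> z < x"
        unfolding z_def by (rule someI_ex) (use below[of x] in blast)
      define T where "T = {a \<in> S. a < x \<and> z \<le> a}"
      have T: "finite T" "z \<in> T"
        using fin z finite_subset[of T "{a \<in> S. z \<le> a}"] by (auto simp: T_def)
      have eq: "nxt x = Max T" by (simp add: nxt_def T_def z_def)
      have "Max T \<in> T" using T Max_in by blast
      moreover have "a \<le> Max T" if "a \<in> S" "a < x" for a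
      proof (cases "z \<le> a")
        case True
        then show ?thesis using that T by (intro Max_ge) (auto simp: T_def)
      next
        case False
        then show ?thesis using Max_ge[OF T] by simp
      qed
      ultimately show ?thesis unfolding eq by (auto simp: T_def)
    qed
    obtain u where u: "\<forall>a\<in>S. a < u"
    proof
      show "\<forall>a\<in>S. a < (Max (insert 0 {a \<in> S. 0 \<le> a})) + 1"
      proof
        fix a assume a: "a \<in> S"
        then have "a \<le> Max (insert 0 {a \<in> S. 0 \<le> a})"
          using fin by (intro le_Max_insert_0) auto
        then show "a < (Max (insert 0 {a \<in> S. 0 \<le> a})) + 1" by simp
      qed
    qed
    define l where "l i = (nxt ^^ Suc i) u" for i
    have l0: "l 0 = nxt u" and lS: "l (Suc i) = nxt (l i)" for i by (simp_all add: l_def)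
    have inS: "l i \<in> S" for i using nxt by (cases i) (simp_all only: l0 lS)
    have "l (Suc i) < l i" for i using nxt by (simp only: lS)
    then have anti: "strict_antimono_on UNIV l"
      unfolding monotone_on_def
      using lift_Suc_mono_less[of "\<lambda>i. - l i"] by simp
    have inj: "inj l"
      using anti unfolding monotone_on_def inj_def
      by (metis less_irrefl linorder_neqE_nat UNIV_I)
    have unb: "\<not> bdd_below (range l)"
    proof
      assume "bdd_below (range l)"
      then obtain b where "\<forall>i. b \<le> l i" by (auto simp: bdd_below_def)
      then have "range l \<subseteq> {a \<in> S. b \<le> a}" using inS by auto
      then have "finite (range l)" using fin finite_subset by blast
      then show False using inj finite_imageD infinite_UNIV_nat by blast
    qed
    have "S \<subseteq> range l"
    proof
      fix a assume a: "a \<in> S"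
      show "a \<in> range l"
      proof (rule ccontr)
        assume na: "a \<notin> range l"
        have "a \<le> l i" for i
        proof (induction i)
          case 0
          then show ?case using nxt[of u] u a by (simp add: l0)
        next
          case (Suc i)
          then have "a < l i" using na by (metis less_eq_real_def rangeI)
          then show ?case using nxt[of "l i"] a by (simp add: lS)
        qed
        then show False using unb by (auto simp: bdd_below_def)
      qed
    qed
    then have "S = range l" using inS by auto
    then show ?thesis using anti unb by (auto simp: puiseux_support_def)
  qed
qed

lemma puiseux_support_subset: "puiseux_support S \<Longrightarrow> T \<subseteq> S \<Longrightarrow> puiseux_support T"
  unfolding puiseux_support_iff by (blast intro: finite_subset[rotated])

lemma puiseux_support_Un: "puiseux_support S \<Longrightarrow> puiseux_support T \<Longrightarrow> puiseux_support (S \<union> T)"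
proof -
  have "{a \<in> S \<union> T. b \<le> a} = {a \<in> S. b \<le> a} \<union> {a \<in> T. b \<le> a}" for b by auto
  then show "puiseux_support S \<Longrightarrow> puiseux_support T \<Longrightarrow> puiseux_support (S \<union> T)"
    unfolding puiseux_support_iff by simp
qed

lemma puiseux_support_bdd:
  assumes "puiseux_support S" obtains B where "\<And>a. a \<in> S \<Longrightarrow> a \<le> B"
proof
  fix a assume "a \<in> S"
  then show "a \<le> Max (insert 0 {a \<in> S. 0 \<le> a})"
    using assms by (intro le_Max_insert_0) (auto simp: puiseux_support_iff)
qed

lemma puiseux_support_plus:
  assumes "puiseux_support S" "puiseux_support T"
  shows "puiseux_support {a + b | a b. a \<in> S \<and> b \<in> T}"
  unfolding puiseux_support_iff
proof
  fix e
  obtain A B where A: "\<And>a. a \<in> S \<Longrightarrow> a \<le> A" and B: "\<And>a. a \<in> T \<Longrightarrow> a \<le> B"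
    using assms puiseux_support_bdd by metis
  have "{c \<in> {a + b | a b. a \<in> S \<and> b \<in> T}. e \<le> c} \<subseteq>
      (\<lambda>(a, b). a + b) ` ({a \<in> S. e - B \<le> a} \<times> {b \<in> T. e - A \<le> b})"
    using A B by force
  moreover have "finite \<dots>"
    using assms by (intro finite_imageI finite_cartesian_product) (auto simp: puiseux_support_iff)
  ultimately show "finite {c \<in> {a + b | a b. a \<in> S \<and> b \<in> T}. e \<le> c}"
    using finite_subset by blast
qed

typedef puiseux = "{c :: real \<Rightarrow> real. puiseux_support {a. c a \<noteq> 0}}"
  morphisms pcoeff Abs_puiseux
  by (rule exI[of _ "\<lambda>_. 0"]) (simp add: puiseux_support_def)

setup_lifting type_definition_puiseux

lemma puiseux_eqI: "(\<And>a. pcoeff x a = pcoeff y a) \<Longrightarrow> x = y"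
  by transfer auto

subsection \<open>Ring operations\<close>

definition conv :: "(real \<Rightarrow> real) \<Rightarrow> (real \<Rightarrow> real) \<Rightarrow> real \<Rightarrow> real" where
  "conv f g c = (\<Sum>a | f a \<noteq> 0 \<and> g (c - a) \<noteq> 0. f a * g (c - a))"

lemma conv_superset:
  assumes "finite F" "\<And>a. f a \<noteq> 0 \<Longrightarrow> g (c - a) \<noteq> 0 \<Longrightarrow> a \<in> F"
  shows "conv f g c = (\<Sum>a\<in>F. f a * g (c - a))"
  unfolding conv_def using assms by (intro sum.mono_neutral_left) auto

lemma conv_commute: "conv f g c = conv g f c"
  unfolding conv_def
  by (rule sum.reindex_bij_witness[of _ "\<lambda>a. c - a" "\<lambda>a. c - a"]) (auto simp: mult.commute)

lemma conv_superset':
  assumes "finite F" "\<And>a. f (c - a) \<noteq> 0 \<Longrightarrow> g a \<noteq> 0 \<Longrightarrow> a \<in> F"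
  shows "conv f g c = (\<Sum>a\<in>F. f (c - a) * g a)"
  using conv_superset[of F g f c] assms by (simp add: conv_commute[of f] mult.commute)

lemma conv_nz:
  assumes "conv f g c \<noteq> 0"
  obtains a b where "f a \<noteq> 0" "g b \<noteq> 0" "c = a + b"
proof -
  have "{a. f a \<noteq> 0 \<and> g (c - a) \<noteq> 0} \<noteq> {}" using assms unfolding conv_def by (metis sum.empty)
  then obtain a where "f a \<noteq> 0" "g (c - a) \<noteq> 0" by auto
  then show ?thesis using that[of a "c - a"] by simp
qed

lemma conv_support:
  "puiseux_support {a. f a \<noteq> 0} \<Longrightarrow> puiseux_support {a. g a \<noteq> 0} \<Longrightarrow> puiseux_support {a. conv f g a \<noteq> 0}"
  by (rule puiseux_support_subset[OF puiseux_support_plus[of "{a. f a \<noteq> 0}" "{a. g a \<noteq> 0}"]])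
    (auto elim!: conv_nz)

lemma fin_above: "puiseux_support {a. f a \<noteq> 0} \<Longrightarrow> finite {a. f a \<noteq> 0 \<and> b \<le> (a::real)}"
  by (auto simp: puiseux_support_iff)

lemma bound_above:
  fixes f :: "real \<Rightarrow> real"
  assumes "puiseux_support {a. f a \<noteq> 0}" obtains B where "\<And>a. f a \<noteq> 0 \<Longrightarrow> a \<le> B"
  by (rule puiseux_support_bdd[OF assms]) auto

lemma conv_assoc:
  assumes "puiseux_support {a. f a \<noteq> 0}" "puiseux_support {a. g a \<noteq> 0}" "puiseux_support {a. h a \<noteq> 0}"
  shows "conv (conv f g) h e = conv f (conv g h) e"
proof -
  obtain B1 where B1: "\<And>a. f a \<noteq> 0 \<Longrightarrow> a \<le> B1" using assms(1) by (rule bound_above) blast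
  obtain B2 where B2: "\<And>a. g a \<noteq> 0 \<Longrightarrow> a \<le> B2" using assms(2) by (rule bound_above) blast
  obtain B3 where B3: "\<And>a. h a \<noteq> 0 \<Longrightarrow> a \<le> B3" using assms(3) by (rule bound_above) blast
  note B = B1 B2 B3
  define A where "A = {a. f a \<noteq> 0 \<and> e - B2 - B3 \<le> a}"
  define D where "D = {d. h d \<noteq> 0 \<and> e - B1 - B2 \<le> d}"
  have fin: "finite A" "finite D" using assms by (auto simp: A_def D_def fin_above)
  have "conv (conv f g) h e = (\<Sum>d\<in>D. conv f g (e - d) * h d)"
  proof (rule conv_superset'[OF fin(2)])
    fix d assume "conv f g (e - d) \<noteq> 0" "h d \<noteq> 0"
    then obtain a b where "f a \<noteq> 0" "g b \<noteq> 0" "e - d = a + b" by (elim conv_nz)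
    then show "d \<in> D" using B(1)[of a] B(2)[of b] \<open>h d \<noteq> 0\<close> by (simp add: D_def)
  qed
  also have "\<dots> = (\<Sum>d\<in>D. \<Sum>a\<in>A. f a * g (e - d - a) * h d)"
  proof (rule sum.cong[OF refl])
    fix d assume d: "d \<in> D"
    have "conv f g (e - d) = (\<Sum>a\<in>A. f a * g (e - d - a))"
    proof (rule conv_superset[OF fin(1)])
      fix a assume "f a \<noteq> 0" "g (e - d - a) \<noteq> 0"
      then show "a \<in> A" using B(2)[of "e - d - a"] B(3)[of d] d by (simp add: A_def D_def)
    qed
    then show "conv f g (e - d) * h d = (\<Sum>a\<in>A. f a * g (e - d - a) * h d)"
      by (simp add: sum_distrib_right)
  qed
  also have "\<dots> = (\<Sum>a\<in>A. \<Sum>d\<in>D. f a * (g (e - a - d) * h d))"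
    by (subst sum.swap) (simp add: algebra_simps)
  also have "\<dots> = (\<Sum>a\<in>A. f a * conv g h (e - a))"
  proof (rule sum.cong[OF refl])
    fix a assume a: "a \<in> A"
    have "conv g h (e - a) = (\<Sum>d\<in>D. g (e - a - d) * h d)"
    proof (rule conv_superset'[OF fin(2)])
      fix d assume "g (e - a - d) \<noteq> 0" "h d \<noteq> 0"
      then show "d \<in> D" using B(2)[of "e - a - d"] B(1)[of a] a by (simp add: A_def D_def)
    qed
    then show "(\<Sum>d\<in>D. f a * (g (e - a - d) * h d)) = f a * conv g h (e - a)"
      by (simp add: sum_distrib_left)
  qed
  also have "\<dots> = conv f (conv g h) e"
  proof (rule conv_superset[OF fin(1), symmetric])
    fix a assume "conv g h (e - a) \<noteq> 0" "f a \<noteq> 0"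
    then obtain b d where "g b \<noteq> 0" "h d \<noteq> 0" "e - a = b + d" by (elim conv_nz)
    then show "a \<in> A" using B(2)[of b] B(3)[of d] \<open>f a \<noteq> 0\<close> by (simp add: A_def)
  qed
  finally show ?thesis .
qed

lemma conv_add_left:
  assumes "puiseux_support {a. f a \<noteq> 0}" "puiseux_support {a. g a \<noteq> 0}" "puiseux_support {a. h a \<noteq> 0}"
  shows "conv (\<lambda>a. f a + g a) h e = conv f h e + conv g h e"
proof -
  obtain B where B: "\<And>a. h a \<noteq> 0 \<Longrightarrow> a \<le> B"
    using assms(3) by (rule bound_above) blast
  define F where "F = {a. f a \<noteq> 0 \<and> e - B \<le> a} \<union> {a. g a \<noteq> 0 \<and> e - B \<le> a}"
  have fin: "finite F" using assms by (auto simp: F_def fin_above)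
  have in_F: "a \<in> F" if "f a \<noteq> 0 \<or> g a \<noteq> 0" "h (e - a) \<noteq> 0" for a
    using that B[of "e - a"] by (auto simp: F_def)
  have "conv (\<lambda>a. f a + g a) h e = (\<Sum>a\<in>F. (f a + g a) * h (e - a))"
    by (rule conv_superset[OF fin]) (metis add.left_neutral in_F)
  also have "\<dots> = (\<Sum>a\<in>F. f a * h (e - a)) + (\<Sum>a\<in>F. g a * h (e - a))"
    by (simp add: distrib_right sum.distrib)
  also have "(\<Sum>a\<in>F. f a * h (e - a)) = conv f h e"
    by (rule conv_superset[OF fin, symmetric]) (use in_F in auto)
  also have "(\<Sum>a\<in>F. g a * h (e - a)) = conv g h e"
    by (rule conv_superset[OF fin, symmetric]) (use in_F in auto)
  finally show ?thesis .
qed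

lift_definition pmonom :: "real \<Rightarrow> real \<Rightarrow> puiseux" is "\<lambda>r l a. if a = l then r else 0"
  by (simp add: puiseux_support_def)

lemma conv_single_left: "conv (\<lambda>a. if a = l then r else 0) g e = r * g (e - l)"
  by (subst conv_superset[of "{l}"]) (auto split: if_splits)

instantiation puiseux :: comm_ring_1
begin

lift_definition zero_puiseux :: puiseux is "\<lambda>_. 0"
  by (simp add: puiseux_support_def)

lift_definition one_puiseux :: puiseux is "\<lambda>a. if a = 0 then 1 else 0"
  by (simp add: puiseux_support_def)

lift_definition uminus_puiseux :: "puiseux \<Rightarrow> puiseux" is "\<lambda>f a. - f a"
  by simp

lift_definition plus_puiseux :: "puiseux \<Rightarrow> puiseux \<Rightarrow> puiseux" is "\<lambda>f g a. f a + g a"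
  by (erule (1) puiseux_support_subset[OF puiseux_support_Un]) auto

lift_definition minus_puiseux :: "puiseux \<Rightarrow> puiseux \<Rightarrow> puiseux" is "\<lambda>f g a. f a - g a"
  by (erule (1) puiseux_support_subset[OF puiseux_support_Un]) auto

lift_definition times_puiseux :: "puiseux \<Rightarrow> puiseux \<Rightarrow> puiseux" is conv
  by (rule conv_support)

instance
proof
  fix a b c :: puiseux
  show "a + b + c = a + (b + c)" "a + b = b + a" "0 + a = a" "- a + a = 0" "a - b = a + - b"
    by (transfer; simp add: fun_eq_iff)+
  show "a * b * c = a * (b * c)" by transfer (simp add: fun_eq_iff conv_assoc)
  show "a * b = b * a" by transfer (simp add: fun_eq_iff conv_commute)
  show "1 * a = a" by transfer (simp add: fun_eq_iff conv_single_left)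
  show "(a + b) * c = a * c + b * c" by transfer (simp add: fun_eq_iff conv_add_left)
  show "(0 :: puiseux) \<noteq> 1" by transfer (auto simp: fun_eq_iff)
qed

end

lemma pcoeff_0 [simp]: "pcoeff 0 a = 0"
  and pcoeff_1: "pcoeff 1 a = (if a = 0 then 1 else 0)"
  and pcoeff_uminus [simp]: "pcoeff (- x) a = - pcoeff x a"
  and pcoeff_add [simp]: "pcoeff (x + y) a = pcoeff x a + pcoeff y a"
  and pcoeff_diff [simp]: "pcoeff (x - y) a = pcoeff x a - pcoeff y a"
  and pcoeff_mult: "pcoeff (x * y) a = conv (pcoeff x) (pcoeff y) a"
  and pcoeff_pmonom: "pcoeff (pmonom r l) a = (if a = l then r else 0)"
  by (transfer; simp)+

lemma pcoeff_sum [simp]: "pcoeff (\<Sum>i\<in>I. f i) a = (\<Sum>i\<in>I. pcoeff (f i) a)"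
  by (induction I rule: infinite_finite_induct) auto

lemma pcoeff_support: "puiseux_support {a. pcoeff x a \<noteq> 0}"
  using pcoeff by simp

subsection \<open>Leading exponent, leading coefficient and valuation\<close>

definition lead_exp :: "puiseux \<Rightarrow> real" where
  "lead_exp x = (GREATEST a. pcoeff x a \<noteq> 0)"

definition lc :: "puiseux \<Rightarrow> real" where
  "lc x = (if x = 0 then 0 else pcoeff x (lead_exp x))"

definition val :: "puiseux \<Rightarrow> ereal" where
  "val x = (if x = 0 then -\<infinity> else ereal (lead_exp x))"

lemma lead_exp:
  assumes "x \<noteq> 0"
  shows "pcoeff x (lead_exp x) \<noteq> 0" "pcoeff x a \<noteq> 0 \<Longrightarrow> a \<le> lead_exp x"
proof -
  obtain b where b: "pcoeff x b \<noteq> 0" using assms puiseux_eqI[of x 0] by auto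
  define S where "S = {a. pcoeff x a \<noteq> 0 \<and> b \<le> a}"
  have S: "finite S" "b \<in> S" using b by (auto simp: S_def fin_above pcoeff_support)
  have M: "Max S \<in> S" using S Max_in by blast
  have ub: "a \<le> Max S" if "pcoeff x a \<noteq> 0" for a
  proof (cases "b \<le> a")
    case True
    then show ?thesis using that S by (intro Max_ge) (auto simp: S_def)
  next
    case False
    then show ?thesis using Max_ge[OF S] by linarith
  qed
  have eq: "lead_exp x = Max S"
    unfolding lead_exp_def using M ub by (intro Greatest_equality) (auto simp: S_def)
  show "pcoeff x (lead_exp x) \<noteq> 0" using M by (simp add: eq S_def)
  show "a \<le> lead_exp x" if "pcoeff x a \<noteq> 0" using ub that eq by simp
qed

lemma lead_expI:
  assumes "pcoeff x l \<noteq> 0" "\<And>a. pcoeff x a \<noteq> 0 \<Longrightarrow> a \<le> l"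
  shows "lead_exp x = l" "lc x = pcoeff x l" "x \<noteq> 0"
proof -
  show "x \<noteq> 0" using assms(1) by auto
  show "lead_exp x = l" unfolding lead_exp_def using assms by (intro Greatest_equality) auto
  then show "lc x = pcoeff x l" using \<open>x \<noteq> 0\<close> by (simp add: lc_def)
qed

lemma lc_eq_0_iff [simp]: "lc x = 0 \<longleftrightarrow> x = 0"
  by (simp add: lc_def lead_exp)

lemma lc_0 [simp]: "lc 0 = 0"
  by simp

lemma lc_uminus [simp]: "lc (- x) = - lc x"
  by (simp add: lc_def lead_exp_def)

lemma lead_mult:
  assumes "x \<noteq> 0" "y \<noteq> 0"
  shows "lead_exp (x * y) = lead_exp x + lead_exp y" "lc (x * y) = lc x * lc y" "x * y \<noteq> 0"
proof -
  have "pcoeff (x * y) (lead_exp x + lead_exp y) =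
      (\<Sum>a\<in>{lead_exp x}. pcoeff x a * pcoeff y (lead_exp x + lead_exp y - a))"
    unfolding pcoeff_mult
  proof (rule conv_superset)
    fix a assume "pcoeff x a \<noteq> 0" "pcoeff y (lead_exp x + lead_exp y - a) \<noteq> 0"
    then have "a \<le> lead_exp x" "lead_exp x + lead_exp y - a \<le> lead_exp y"
      using lead_exp assms by blast+
    then show "a \<in> {lead_exp x}" by simp
  qed simp
  then have eq: "pcoeff (x * y) (lead_exp x + lead_exp y) = lc x * lc y"
    using assms by (simp add: lc_def)
  have nz: "pcoeff (x * y) (lead_exp x + lead_exp y) \<noteq> 0"
    unfolding eq using assms by simp
  have ub: "a \<le> lead_exp x + lead_exp y" if "pcoeff (x * y) a \<noteq> 0" for a
    using that unfolding pcoeff_mult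
    by (elim conv_nz) (use lead_exp(2) assms add_mono in blast)
  show "lead_exp (x * y) = lead_exp x + lead_exp y" "lc (x * y) = lc x * lc y" "x * y \<noteq> 0"
    using lead_expI[OF nz ub] eq by auto
qed

lemma lc_add_pos:
  assumes "lc x > 0" "lc y > 0"
  shows "lc (x + y) > 0"
proof -
  have nz: "x \<noteq> 0" "y \<noteq> 0" using assms by (auto simp: lc_def)
  have ge: "0 \<le> pcoeff z a" if "lc z > 0" "lead_exp z \<le> a" for z a
  proof (cases "a = lead_exp z")
    case True
    then show ?thesis using that by (auto simp: lc_def split: if_splits)
  next
    case False
    moreover have "z \<noteq> 0" using that by (auto simp: lc_def)
    ultimately have "pcoeff z a = 0" using lead_exp(2)[of z a] that by force
    then show ?thesis by simp
  qed
  define l where "l = max (lead_exp x) (lead_exp y)"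
  have "pcoeff x l \<ge> 0" "pcoeff y l \<ge> 0"
    using assms by (auto intro!: ge simp: l_def)
  moreover have "pcoeff x l > 0 \<or> pcoeff y l > 0"
    using assms nz by (auto simp: l_def max_def lc_def)
  ultimately have pos: "pcoeff (x + y) l > 0" by auto
  have ub: "a \<le> l" if "pcoeff (x + y) a \<noteq> 0" for a
  proof -
    have "pcoeff x a \<noteq> 0 \<or> pcoeff y a \<noteq> 0" using that by auto
    then have "a \<le> lead_exp x \<or> a \<le> lead_exp y" using lead_exp(2) nz by blast
    then show ?thesis by (auto simp: l_def)
  qed
  show ?thesis using lead_expI(2)[of "x + y" l] pos ub by auto
qed

instantiation puiseux :: linordered_idom
begin

definition less_eq_puiseux :: "puiseux \<Rightarrow> puiseux \<Rightarrow> bool" where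
  "y \<le> x \<longleftrightarrow> lc (x - y) \<ge> 0"

definition less_puiseux :: "puiseux \<Rightarrow> puiseux \<Rightarrow> bool" where
  "y < x \<longleftrightarrow> y \<le> x \<and> \<not> x \<le> (y :: puiseux)"

definition abs_puiseux :: "puiseux \<Rightarrow> puiseux" where
  "\<bar>x :: puiseux\<bar> = (if x < 0 then - x else x)"

definition sgn_puiseux :: "puiseux \<Rightarrow> puiseux" where
  "sgn (x :: puiseux) = (if x = 0 then 0 else if 0 < x then 1 else - 1)"

instance
proof
  have less: "y < x \<longleftrightarrow> lc (x - y) > 0" for x y :: puiseux
    using lc_uminus[of "x - y"] by (auto simp: less_puiseux_def less_eq_puiseux_def)
  fix x y z :: puiseux
  show "x < y \<longleftrightarrow> x \<le> y \<and> \<not> y \<le> x" by (simp add: less_puiseux_def)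
  show "x \<le> x" by (simp add: less_eq_puiseux_def)
  show "x \<le> z" if "x \<le> y" "y \<le> z"
  proof (cases "lc (y - x) = 0 \<or> lc (z - y) = 0")
    case True
    then show ?thesis using that by auto
  next
    case False
    then have "lc (y - x) > 0" "lc (z - y) > 0" using that unfolding less_eq_puiseux_def by linarith+
    then show ?thesis using lc_add_pos[of "y - x" "z - y"] by (simp add: less_eq_puiseux_def)
  qed
  show "x = y" if "x \<le> y" "y \<le> x"
  proof -
    have "lc (x - y) = 0" using that lc_uminus[of "x - y"] by (simp add: less_eq_puiseux_def)
    then show ?thesis by simp
  qed
  show "x \<le> y \<or> y \<le> x"
    using lc_uminus[of "x - y"] by (auto simp: less_eq_puiseux_def)
  show "z + x \<le> z + y" if "x \<le> y" using that by (simp add: less_eq_puiseux_def)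
  show "z * x < z * y" if "x < y" "0 < z"
  proof -
    have "lc (z * (y - x)) = lc z * lc (y - x)"
      using that by (intro lead_mult) (auto simp: less)
    then show ?thesis using that by (simp add: less right_diff_distrib)
  qed
qed (simp_all add: abs_puiseux_def sgn_puiseux_def)

end

subsection \<open>Inverses\<close>

lemma pcoeff_mult_le:
  assumes "\<And>a. pcoeff x a \<noteq> 0 \<Longrightarrow> a \<le> A" "\<And>b. pcoeff y b \<noteq> 0 \<Longrightarrow> b < B" "A + B \<le> e"
  shows "pcoeff (x * y) e = 0"
proof (rule ccontr)
  assume "pcoeff (x * y) e \<noteq> 0"
  then obtain a b where "pcoeff x a \<noteq> 0" "pcoeff y b \<noteq> 0" "e = a + b"
    unfolding pcoeff_mult by (elim conv_nz)
  then show False using assms(1)[of a] assms(2)[of b] assms(3) by simp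
qed

lemma ex_inverse_one_minus:
  assumes h: "\<And>a. pcoeff h a \<noteq> 0 \<Longrightarrow> a \<le> - d" and d: "d > 0"
  shows "\<exists>G. (1 - h) * G = 1"
proof -
  have pow: "a \<le> - (of_nat k * d)" if "pcoeff (h ^ k) a \<noteq> 0" for a k
    using that
  proof (induction k arbitrary: a)
    case 0
    then show ?case by (auto simp: pcoeff_1 split: if_splits)
  next
    case (Suc k)
    from Suc.prems obtain b c where bc: "pcoeff h b \<noteq> 0" "pcoeff (h ^ k) c \<noteq> 0" "a = b + c"
      unfolding power_Suc pcoeff_mult by (elim conv_nz)
    then show ?case using h[OF bc(1)] Suc.IH[OF bc(2)] by (simp add: algebra_simps)
  qed
  define N where "N a = Suc (nat \<lceil>- a / d\<rceil>)" for a :: real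
  have Nle: "N a \<le> N b" if "b \<le> a" for a b
    using that d unfolding N_def by (intro Suc_le_mono[THEN iffD2] nat_mono ceiling_mono divide_right_mono) auto
  have zero: "pcoeff (h ^ k) a = 0" if "N a \<le> k" for a k
  proof (rule ccontr)
    assume "pcoeff (h ^ k) a \<noteq> 0"
    then have "a \<le> - (of_nat k * d)" by (rule pow)
    then have "of_nat k \<le> - a / d" using d by (simp add: field_simps)
    then have "real k \<le> of_int \<lceil>- a / d\<rceil>" by linarith
    then show False using that unfolding N_def by linarith
  qed
  define g where "g a = (\<Sum>k<N a. pcoeff (h ^ k) a)" for a
  have g_eq: "g a = pcoeff (\<Sum>k<n. h ^ k) a" if "N a \<le> n" for a n
    unfolding g_def pcoeff_sum using that zero by (intro sum.mono_neutral_left) auto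
  have sup: "puiseux_support {a. g a \<noteq> 0}"
    unfolding puiseux_support_iff
  proof
    fix b
    have "{a \<in> {a. g a \<noteq> 0}. b \<le> a} \<subseteq> {a. pcoeff (\<Sum>k<N b. h ^ k) a \<noteq> 0 \<and> b \<le> a}"
      using g_eq[OF Nle] by auto
    then show "finite {a \<in> {a. g a \<noteq> 0}. b \<le> a}"
      using fin_above[OF pcoeff_support] finite_subset by blast
  qed
  define G where "G = Abs_puiseux g"
  have G: "pcoeff G a = g a" for a using sup by (simp add: G_def Abs_puiseux_inverse)
  have "(1 - h) * G = 1"
  proof (rule puiseux_eqI)
    fix e
    define S where "S = (\<Sum>k<N e. h ^ k)"
    have "b < e" if "pcoeff (G - S) b \<noteq> 0" for b
    proof (rule ccontr)
      assume "\<not> b < e"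
      then have "N b \<le> N e" by (intro Nle) simp
      then show False using that g_eq[of b "N e"] by (simp add: G S_def)
    qed
    moreover have "a \<le> 0" if "pcoeff (1 - h) a \<noteq> 0" for a
      using that h[of a] d by (cases "pcoeff h a = 0") (auto simp: pcoeff_1 split: if_splits)
    ultimately have "pcoeff ((1 - h) * (G - S)) e = 0"
      by (intro pcoeff_mult_le[of _ 0 _ e]) auto
    moreover have "(1 - h) * S = 1 - h ^ N e"
      unfolding S_def by (simp add: one_diff_power_eq)
    moreover have "(1 - h) * G = (1 - h) * (G - S) + (1 - h) * S"
      by (simp add: algebra_simps)
    ultimately show "pcoeff ((1 - h) * G) e = pcoeff 1 e"
      using zero[of e "N e"] by simp
  qed
  then show ?thesis ..
qed

lemma puiseux_ex_inverse:
  fixes x :: puiseux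
  assumes x: "x \<noteq> 0"
  shows "\<exists>y. y * x = 1"
proof -
  define l where "l = lead_exp x"
  define u where "u = pmonom (1 / lc x) (- l)"
  define h where "h = 1 - u * x"
  have lcx: "pcoeff x l \<noteq> 0" "lc x = pcoeff x l" using x lead_exp by (simp_all add: l_def lc_def)
  have "pmonom r s * y = z \<longleftrightarrow> (\<forall>a. r * pcoeff y (a - s) = pcoeff z a)" for r s y z
    by transfer (auto simp: fun_eq_iff conv_single_left)
  then have ux: "pcoeff (u * x) a = pcoeff x (a + l) / lc x" for a
    unfolding u_def by (metis diff_minus_eq_add mult.commute mult.right_neutral times_divide_eq_right)
  have neg: "a < 0" if "pcoeff h a \<noteq> 0" for a
  proof -
    have "a \<noteq> 0" using that lcx by (auto simp: h_def ux pcoeff_1)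
    then have "pcoeff x (a + l) \<noteq> 0" using that by (auto simp: h_def ux pcoeff_1)
    then have "a + l \<le> l" unfolding l_def by (rule lead_exp(2)[OF x])
    then show ?thesis using \<open>a \<noteq> 0\<close> by simp
  qed
  have "\<exists>d>0. \<forall>a. pcoeff h a \<noteq> 0 \<longrightarrow> a \<le> - d"
  proof (cases "h = 0")
    case True
    then show ?thesis by (intro exI[of _ 1]) simp
  next
    case False
    then show ?thesis
      using neg[OF lead_exp(1)] lead_exp(2)[OF False] by (intro exI[of _ "- lead_exp h"]) auto
  qed
  then obtain G where "(1 - h) * G = 1" using ex_inverse_one_minus by metis
  then have "(G * u) * x = 1" by (simp add: h_def mult_ac)
  then show ?thesis ..
qed

instantiation puiseux :: linordered_field
begin

definition inverse_puiseux :: "puiseux \<Rightarrow> puiseux" where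
  "inverse (x :: puiseux) = (if x = 0 then 0 else (THE y. y * x = 1))"

definition divide_puiseux :: "puiseux \<Rightarrow> puiseux \<Rightarrow> puiseux" where
  "x div y = x * inverse (y :: puiseux)"

instance
proof
  fix x y :: puiseux
  show "inverse x * x = 1" if x: "x \<noteq> 0"
  proof -
    obtain y where y: "y * x = 1" using puiseux_ex_inverse[OF x] by blast
    have "\<exists>!y. y * x = 1"
    proof (rule ex1I, rule y)
      fix z assume "z * x = 1"
      then show "z = y" using y by (metis mult.assoc mult.commute mult.right_neutral)
    qed
    from theI'[OF this] show ?thesis using x by (simp add: inverse_puiseux_def)
  qed
  show "x div y = x * inverse y" by (simp add: divide_puiseux_def)
  show "inverse (0::puiseux) = 0" by (simp add: inverse_puiseux_def)
qed

end

section \<open>Spectrahedra over Puiseux series\<close>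

text \<open>
  The coefficient matrices of a pencil are indexed by a finite type \<open>'n\<close>, their rows and
  columns by a finite type \<open>'m\<close>.
\<close>

definition psd :: "'a::linordered_field ^ 'm ^ 'm \<Rightarrow> bool" where
  "psd A \<longleftrightarrow> transpose A = A \<and> (\<forall>v. 0 \<le> (\<Sum>i\<in>UNIV. v $ i * (A *v v) $ i))"

definition pencil :: "('n::finite \<Rightarrow> 'a::comm_ring_1 ^ 'm ^ 'm) \<Rightarrow> 'a ^ 'n \<Rightarrow> 'a ^ 'm ^ 'm" where
  "pencil Q x = (\<chi> i j. \<Sum>k\<in>UNIV. x $ k * Q k $ i $ j)"

definition spectrahedron ::
    "('n::finite \<Rightarrow> 'a::linordered_field ^ 'm ^ 'm) \<Rightarrow> ('a ^ 'n) set" where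
  "spectrahedron Q = {x. (\<forall>k. 0 \<le> x $ k) \<and> psd (pencil Q x)}"

definition val_vec :: "puiseux ^ 'n \<Rightarrow> ereal ^ 'n" where
  "val_vec x = (\<chi> k. val (x $ k))"

section \<open>Tropical numbers\<close>

text \<open>
  Tropical numbers are the extended reals different from \<open>\<infinity>\<close>. The supremum of the empty
  set in \<^typ>\<open>ereal\<close> is \<open>-\<infinity>\<close>, and \<open>0 * (-\<infinity>) = 0\<close> there, as required of tropical monomials.
\<close>

definition trop_space :: "(ereal ^ 'n) set" where
  "trop_space = {x. \<forall>k. x $ k \<noteq> \<infinity>}"

text \<open>Signed tropical numbers are pairs (sign, modulus); the tropical zero is \<open>(0, -\<infinity>)\<close>.\<close>

type_synonym signed_trop = "int \<times> ereal"

definition trop_pos :: "signed_trop set" where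
  "trop_pos = {(1, ereal a) | a. True}"

definition trop_neg :: "signed_trop set" where
  "trop_neg = {(- 1, ereal a) | a. True}"

definition modulus :: "signed_trop \<Rightarrow> ereal" where
  "modulus = snd"

definition sval :: "puiseux \<Rightarrow> signed_trop" where
  "sval x = ((if x = 0 then 0 else if 0 < x then 1 else - 1), val x)"

definition sval_mats :: "('n \<Rightarrow> puiseux ^ 'm ^ 'm) \<Rightarrow> 'n \<Rightarrow> signed_trop ^ 'm ^ 'm" where
  "sval_mats Q k = map_matrix sval (Q k)"

section \<open>Formal tropicalization\<close>

type_synonym ('n, 'a) mpoly = "('n \<Rightarrow>\<^sub>0 nat) \<Rightarrow>\<^sub>0 'a"

definition Var :: "'n \<Rightarrow> ('n, 'a::comm_ring_1) mpoly" where
  "Var k = Poly_Mapping.single (Poly_Mapping.single k 1) 1"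

definition Const :: "'a \<Rightarrow> ('n, 'a::comm_ring_1) mpoly" where
  "Const c = Poly_Mapping.single 0 c"

definition trop_monom :: "('n::finite, puiseux) mpoly \<Rightarrow> ('n \<Rightarrow>\<^sub>0 nat) \<Rightarrow> ereal ^ 'n \<Rightarrow> ereal" where
  "trop_monom P \<alpha> x =
     val (Poly_Mapping.lookup P \<alpha>) + (\<Sum>k\<in>UNIV. ereal (real (Poly_Mapping.lookup \<alpha> k)) * x $ k)"

definition ftrop_plus :: "('n::finite, puiseux) mpoly \<Rightarrow> ereal ^ 'n \<Rightarrow> ereal" where
  "ftrop_plus P x = (SUP \<alpha>\<in>{\<alpha>. Poly_Mapping.lookup P \<alpha> > 0}. trop_monom P \<alpha> x)"

definition ftrop_minus :: "('n::finite, puiseux) mpoly \<Rightarrow> ereal ^ 'n \<Rightarrow> ereal" where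
  "ftrop_minus P x = (SUP \<alpha>\<in>{\<alpha>. Poly_Mapping.lookup P \<alpha> < 0}. trop_monom P \<alpha> x)"

definition entry_poly ::
    "('n::finite \<Rightarrow> 'a::comm_ring_1 ^ 'm ^ 'm) \<Rightarrow> 'm \<Rightarrow> 'm \<Rightarrow> ('n, 'a) mpoly" where
  "entry_poly Q i j = (\<Sum>k\<in>UNIV. Var k * Const (Q k $ i $ j))"

definition minor_poly ::
    "('n::finite \<Rightarrow> 'a::comm_ring_1 ^ 'm ^ 'm) \<Rightarrow> 'm \<Rightarrow> 'm \<Rightarrow> ('n, 'a) mpoly" where
  "minor_poly Q i j =
     entry_poly Q i i * entry_poly Q j j - (entry_poly Q i j)\<^sup>2"

definition formal_set :: "('n::finite \<Rightarrow> puiseux ^ 'm ^ 'm) \<Rightarrow> (ereal ^ 'n) set" where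
  "formal_set Q = {x \<in> trop_space.
     (\<forall>i. ftrop_plus (entry_poly Q i i) x \<ge> ftrop_minus (entry_poly Q i i) x) \<and>
     (\<forall>i j. i \<noteq> j \<longrightarrow> ftrop_plus (minor_poly Q i j) x \<ge> ftrop_minus (minor_poly Q i j) x)}"

section \<open>The tropical sets and their strata\<close>

definition Qplus ::
    "('n::finite \<Rightarrow> signed_trop ^ 'm ^ 'm) \<Rightarrow> 'm \<Rightarrow> 'm \<Rightarrow> ereal ^ 'n \<Rightarrow> ereal" where
  "Qplus Q i j x = (SUP k\<in>{k. Q k $ i $ j \<in> trop_pos}. modulus (Q k $ i $ j) + x $ k)"

definition Qminus ::
    "('n::finite \<Rightarrow> signed_trop ^ 'm ^ 'm) \<Rightarrow> 'm \<Rightarrow> 'm \<Rightarrow> ereal ^ 'n \<Rightarrow> ereal" where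
  "Qminus Q i j x = (SUP k\<in>{k. Q k $ i $ j \<in> trop_neg}. modulus (Q k $ i $ j) + x $ k)"

text \<open>
  The row indices form a finite linearly ordered type, so that \<open>i < j\<close> makes sense.
  \<open>R\<close> assigns a comparison \<open>\<le>\<close> or \<open>\<ge>\<close> to each pair \<open>i < j\<close> outside \<open>\<Sigma>\<close>.
\<close>

definition pairs_compl :: "('m::linorder \<times> 'm) set \<Rightarrow> ('m \<times> 'm) set" where
  "pairs_compl \<Sigma> = {(i, j). i < j \<and> (i, j) \<notin> \<Sigma>}"

definition trop_region ::
    "('m::{finite,linorder} \<times> 'm) set \<Rightarrow> ('m \<times> 'm \<Rightarrow> ereal \<Rightarrow> ereal \<Rightarrow> bool) \<Rightarrow>
     ('n::finite \<Rightarrow> signed_trop ^ 'm::{finite,linorder} ^ 'm::{finite,linorder}) \<Rightarrow> (ereal ^ 'n) set" where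
  "trop_region \<Sigma> R Q = {x \<in> trop_space.
     (\<forall>i. Qplus Q i i x \<ge> Qminus Q i i x) \<and>
     (\<forall>(i, j)\<in>\<Sigma>. Qplus Q i i x + Qplus Q j j x \<ge> 2 * max (Qplus Q i j x) (Qminus Q i j x)) \<and>
     (\<forall>(i, j)\<in>pairs_compl \<Sigma>. R (i, j) (Qplus Q i j x) (Qminus Q i j x))}"

text \<open>Points of \<open>\<real>\<^sup>K\<close> are functions that are extensional on \<open>K\<close>.\<close>

definition stratum :: "'n set \<Rightarrow> (ereal ^ 'n) set \<Rightarrow> ('n \<Rightarrow> real) set" where
  "stratum K S = {\<lambda>k\<in>K. real_of_ereal (x $ k) | x. x \<in> S \<and> {k. x $ k \<noteq> -\<infinity>} = K}"

definition regular_in :: "'n set \<Rightarrow> ('n \<Rightarrow> real) set \<Rightarrow> bool" where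
  "regular_in K S \<longleftrightarrow>
     closedin (powertop_real K) S \<and>
     S = powertop_real K closure_of (powertop_real K interior_of S)"

end

theory Submission
  imports Defs
begin

text \<open>
  Write \<open>Q\<^sub>i\<^sub>j(z)\<close> for the entries of the pencil, and \<open>Q\<^sub>i\<^sub>j\<^sup>+\<close>, \<open>Q\<^sub>i\<^sub>j\<^sup>-\<close> for the maxima of the
  valuations of its positive and of its negative terms, as functions of a tropical point.

  The valuations of the points of the spectrahedron satisfy the formal inequalities because a
  positive semidefinite matrix has nonnegative diagonal entries and \<open>2 \<times> 2\<close> principal minors, and
  because a polynomial that is nonnegative at a nonnegative point \<open>z\<close> cannot have a negative term
  whose valuation exceeds the valuations of all positive terms
  (\<open>ftrop_minus_le_plus_if_eval_nonneg\<close>).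

  For the converse, let \<open>x\<close> satisfy the formal inequalities. If \<open>Q\<^sub>i\<^sub>j\<^sup>+\<close> and \<open>Q\<^sub>i\<^sub>j\<^sup>-\<close> differ at \<open>x\<close>
  and the larger of them, doubled, exceeds \<open>Q\<^sub>i\<^sub>i\<^sup>+ + Q\<^sub>j\<^sub>j\<^sup>+\<close>, then the largest term of the minor is
  the square of the dominant term of \<open>Q\<^sub>i\<^sub>j\<close>. This square has a negative coefficient, which nothing
  of the same valuation cancels, and so the formal inequality fails. Hence, for every pair
  \<open>i < j\<close>, either \<open>Q\<^sub>i\<^sub>i\<^sup>+ + Q\<^sub>j\<^sub>j\<^sup>+ \<ge> 2 max(Q\<^sub>i\<^sub>j\<^sup>+, Q\<^sub>i\<^sub>j\<^sup>-)\<close> or \<open>Q\<^sub>i\<^sub>j\<^sup>+ = Q\<^sub>i\<^sub>j\<^sup>-\<close>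
  (\<open>offdiagonal_condition_if_minor\<close>). Let \<open>\<Sigma>\<close> be the set of the pairs of the first kind. A pair
  of the second kind satisfies both comparisons, so \<open>x\<close> lies in the regions of \<open>\<Sigma>\<close> for all choices
  of comparisons on the complement of \<open>\<Sigma>\<close>.

  Fix such a choice. By regularity there are points \<open>y\<close> of the region arbitrarily close to \<open>x\<close> with
  the same support and off finitely many hyperplanes (\<open>regular_generic_approximation\<close>). At \<open>y\<close> no
  two terms that have to be compared are equal, unless both are multiples of one square \<open>X\<^sub>k\<^sup>2\<close>; for
  these the genericity hypothesis on the matrices applies. The lift with
  \<open>z\<^sub>k = s powr (y\<^sub>k - x\<^sub>k) t\<^bsup>x\<^sub>k\<^esup>\<close> on the support and \<open>z\<^sub>k = 0\<close> elsewhere has valuation \<open>x\<close>,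
  not \<open>y\<close>. If a term is larger than another one at \<open>y\<close>, it is at least as large at \<open>x\<close>, because
  \<open>y\<close> is close to \<open>x\<close>. In case of equality at \<open>x\<close> the real factors decide, for large \<open>s\<close>, in
  favour of the same term (\<open>ex_dominating_lift\<close>). So the strict
  inequalities at \<open>y\<close> become inequalities between \<open>Q\<^sub>i\<^sub>i(z) Q\<^sub>j\<^sub>j(z)\<close> and any given multiple of
  \<open>Q\<^sub>i\<^sub>j(z)\<^sup>2\<close> for the pairs in \<open>\<Sigma>\<close>, and they determine the signs of the other off-diagonal entries
  (\<open>ex_lift_with_signs\<close>).

  These lifts, one for each sign pattern, lie in a convex set, on which all points have valuation
  \<open>x\<close>. Taking convex combinations, one off-diagonal entry at a time, makes all the entries outside
  \<open>\<Sigma>\<close> vanish (\<open>common_zero_if_all_signs\<close>). The resulting matrix is positive semidefinite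
  because \<open>m\<^sup>2 Q\<^sub>i\<^sub>j\<^sup>2 \<le> Q\<^sub>i\<^sub>i Q\<^sub>j\<^sub>j\<close> for all \<open>i \<noteq> j\<close> (\<open>psd_if_diagonally_dominant\<close>).
\<close>

section \<open>The order and the valuation on Puiseux series\<close>

lemma lc_pos_iff: "0 < lc x \<longleftrightarrow> 0 < x"
proof -
  have "0 \<le> x \<longleftrightarrow> 0 \<le> lc x" by (simp add: less_eq_puiseux_def)
  then show ?thesis using lc_eq_0_iff[of x] unfolding order.strict_iff_order by auto
qed

lemma pcoeff_above_lead_exp: "lead_exp x < a \<Longrightarrow> pcoeff x a = 0"
  using lead_exp(2)[of x a] by (cases "x = 0") force+

lemma pos_if_top_pcoeff_pos:
  assumes "0 < pcoeff d l" "\<And>a. l < a \<Longrightarrow> pcoeff d a = 0"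
  shows "0 < d"
proof -
  have "lc d = pcoeff d l"
    using assms by (intro lead_expI(2)) (auto simp: not_less[symmetric])
  then show ?thesis using assms(1) by (simp flip: lc_pos_iff)
qed

lemma less_if_lead_exp_less:
  assumes "0 < u" "lead_exp w < lead_exp u"
  shows "w < u"
proof -
  have "0 < lc u" "u \<noteq> 0" using assms(1) by (simp_all add: lc_pos_iff)
  then have "0 < u - w"
    using assms(2)
    by (intro pos_if_top_pcoeff_pos[of _ "lead_exp u"])
       (auto simp: pcoeff_above_lead_exp lc_def split: if_splits)
  then show ?thesis by simp
qed

lemma less_if_lc_less:
  assumes "u \<noteq> 0" "w \<noteq> 0" "lead_exp w = lead_exp u" "lc w < lc u"
  shows "w < u"
proof -
  have "0 < u - w"
    using assms
    by (intro pos_if_top_pcoeff_pos[of _ "lead_exp u"])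
       (auto simp: pcoeff_above_lead_exp lc_def)
  then show ?thesis by simp
qed

lemma val_neq_PInf [simp]: "val x \<noteq> \<infinity>"
  by (simp add: val_def)

lemma val_0 [simp]: "val 0 = -\<infinity>"
  by (simp add: val_def)

lemma val_eq_MInf_iff [simp]: "val x = -\<infinity> \<longleftrightarrow> x = 0"
  by (simp add: val_def)

lemma val_nonzero: "x \<noteq> 0 \<Longrightarrow> val x = ereal (lead_exp x)"
  by (simp add: val_def)

lemma val_uminus [simp]: "val (- x) = val x"
  by (simp add: val_def lead_exp_def)

lemma val_mult: "val (x * y) = val x + val y"
  by (auto simp: val_def lead_mult)

lemma pcoeff_of_nat: "pcoeff (of_nat n) a = (if a = 0 then real n else 0)"
  by (induction n) (auto simp: pcoeff_1)

lemma lead_of_nat: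
  assumes "n \<noteq> 0"
  shows "lead_exp (of_nat n) = 0" "lc (of_nat n) = real n"
  using lead_expI[of "of_nat n" 0] assms by (auto simp: pcoeff_of_nat split: if_splits)

lemma val_of_nat: "n \<noteq> 0 \<Longrightarrow> val (of_nat n) = 0"
  by (simp add: val_def lead_of_nat zero_ereal_def)

lemma val_1 [simp]: "val 1 = 0"
  using val_of_nat[of 1] by simp

lemma val_power: "val (x ^ n) = ereal (real n) * val x"
proof (induction n)
  case (Suc n)
  show ?case
  proof (cases "x = 0")
    case False
    then show ?thesis using Suc by (simp add: val_mult val_nonzero algebra_simps)
  qed simp
qed (simp flip: zero_ereal_def)

lemma val_prod: "finite A \<Longrightarrow> val (\<Prod>k\<in>A. f k) = (\<Sum>k\<in>A. val (f k))"
  by (induction A rule: finite_induct) (auto simp: val_mult)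

lemma less_if_val_less:
  assumes "0 \<le> b" "val a < val b"
  shows "a < b"
proof -
  have b: "0 < b" using assms by (cases "b = 0") auto
  show ?thesis
  proof (cases "a = 0")
    case False
    then have "lead_exp a < lead_exp b" using assms(2) b by (simp add: val_nonzero)
    then show ?thesis using b by (rule less_if_lead_exp_less[rotated])
  qed (use b in simp)
qed

lemma val_mono: "0 \<le> a \<Longrightarrow> a \<le> b \<Longrightarrow> val a \<le> val b"
  using less_if_val_less[of a b] by (meson not_le)

text \<open>
  A summand of smaller valuation does not lower the valuation: as \<open>2 * a < b\<close>, the difference
  is at least \<open>b / 2\<close>.
\<close>

lemma val_diff_ge:
  assumes "0 \<le> b" "val a < val b"
  shows "val b \<le> val (b - a)"
proof -
  have v2: "val (2 * c) = val c" for c using val_of_nat[of 2] by (simp add: val_mult)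
  have "2 * a < b" using assms by (intro less_if_val_less) (simp_all add: v2)
  then have "b \<le> 2 * (b - a)" by simp
  then show ?thesis using val_mono[OF assms(1)] v2 by metis
qed

text \<open>
  A positive sum is at most a multiple of its largest summand, and natural numbers have
  valuation zero.
\<close>

lemma val_sum_pos_le:
  assumes "finite A" "0 < (\<Sum>t\<in>A. c t)"
  obtains t where "t \<in> A" "0 < c t" "val (\<Sum>t\<in>A. c t) \<le> val (c t)"
proof -
  have ne: "A \<noteq> {}" using assms(2) by auto
  obtain t where t: "t \<in> A" "\<And>u. u \<in> A \<Longrightarrow> c u \<le> c t"
    using Max_in[of "c ` A"] Max_ge[of "c ` A"] assms(1) ne by (metis (no_types, opaque_lifting) finite_imageI image_iff image_is_empty)
  have le: "(\<Sum>t\<in>A. c t) \<le> of_nat (card A) * c t" using t(2) by (rule sum_bounded_above)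
  have pos: "0 < c t"
  proof (rule ccontr)
    assume "\<not> 0 < c t"
    then have "of_nat (card A) * c t \<le> 0" by (simp add: mult_nonneg_nonpos)
    then show False using le assms(2) by simp
  qed
  have "val (\<Sum>t\<in>A. c t) \<le> val (of_nat (card A) * c t)"
    using le assms(2) by (intro val_mono) auto
  also have "\<dots> = val (c t)"
    using assms(1) ne by (simp add: val_mult val_of_nat)
  finally show ?thesis using that t pos by blast
qed

lemma val_add_pos_le:
  assumes "0 < a + b"
  shows "0 < a \<and> val (a + b) \<le> val a \<or> 0 < b \<and> val (a + b) \<le> val b"
proof -
  have s: "(\<Sum>t\<in>UNIV. if t then a else b) = a + b" by (simp add: UNIV_bool add.commute)
  show ?thesis
    by (rule val_sum_pos_le[of UNIV "\<lambda>t. if t then a else b"]) (use assms s in \<open>auto split: if_splits\<close>)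
qed

section \<open>Positive semidefinite matrices over an ordered field\<close>

text \<open>
  The inequality of arithmetic and geometric means in a form without square roots, so that it
  makes sense over any ordered field.
\<close>

lemma two_mult_le_add_if_square_le:
  fixes a b q :: "'a::linordered_field"
  assumes "0 \<le> a" "0 \<le> b" "q\<^sup>2 \<le> a * b"
  shows "2 * \<bar>q\<bar> \<le> a + b"
proof (rule power2_le_imp_le)
  have "0 \<le> (a - b)\<^sup>2" by simp
  then show "(2 * \<bar>q\<bar>)\<^sup>2 \<le> (a + b)\<^sup>2"
    using assms(3) by (simp add: power2_eq_square algebra_simps)
qed (use assms in simp)

text \<open>
  By the previous lemma each mixed term \<open>A\<^sub>i\<^sub>j v\<^sub>i v\<^sub>j\<close> of the quadratic form is at least
  \<open>- (A\<^sub>i\<^sub>i v\<^sub>i\<^sup>2 + A\<^sub>j\<^sub>j v\<^sub>j\<^sup>2) / (2 m)\<close>. Summed over all pairs, these bounds consume at most the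
  diagonal part of the form.
\<close>

lemma psd_if_diagonally_dominant:
  fixes A :: "'a::linordered_field ^ 'm ^ 'm"
  assumes sym: "transpose A = A"
    and diag: "\<And>i. 0 \<le> A $ i $ i"
    and off: "\<And>i j. i \<noteq> j \<Longrightarrow> (of_nat CARD('m) * A $ i $ j)\<^sup>2 \<le> A $ i $ i * A $ j $ j"
  shows "psd A"
  unfolding psd_def
proof (intro conjI allI)
  fix v :: "'a ^ 'm"
  define N :: 'a where "N = of_nat CARD('m)"
  have N: "0 < N" by (simp add: N_def)
  define d where "d i = A $ i $ i * (v $ i)\<^sup>2" for i
  have d: "0 \<le> d i" for i using diag by (simp add: d_def)
  have le: "- (d i + d j) / (2 * N) \<le> (if i = j then 0 else v $ i * (A $ i $ j * v $ j))" for i j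
  proof (cases "i = j")
    case True
    then show ?thesis using N d by (simp add: divide_nonpos_nonneg)
  next
    case False
    have "(N * (A $ i $ j * v $ i * v $ j))\<^sup>2 = (N * A $ i $ j)\<^sup>2 * ((v $ i)\<^sup>2 * (v $ j)\<^sup>2)"
      by (simp add: power_mult_distrib)
    also have "\<dots> \<le> (A $ i $ i * A $ j $ j) * ((v $ i)\<^sup>2 * (v $ j)\<^sup>2)"
      using off[OF False] by (intro mult_right_mono) (simp_all add: N_def)
    also have "\<dots> = d i * d j" by (simp add: d_def)
    finally have "2 * \<bar>N * (A $ i $ j * v $ i * v $ j)\<bar> \<le> d i + d j"
      using d by (intro two_mult_le_add_if_square_le) auto
    then have "- (d i + d j) \<le> 2 * (N * (A $ i $ j * v $ i * v $ j))" by linarith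
    then have "- (d i + d j) \<le> (v $ i * (A $ i $ j * v $ j)) * (2 * N)" by (simp add: mult_ac)
    then show ?thesis using N False by (simp add: pos_divide_le_eq)
  qed
  have "(\<Sum>i\<in>UNIV. \<Sum>j\<in>UNIV. - (d i + d j) / (2 * N)) =
      (\<Sum>i\<in>UNIV. \<Sum>j\<in>UNIV. (- 1 / (2 * N)) * (d i + d j))"
    by (simp only: times_divide_eq_left mult_minus1)
  also have "\<dots> = (- 1 / (2 * N)) * (\<Sum>i\<in>UNIV. \<Sum>j\<in>UNIV. d i + d j)"
    by (simp only: sum_distrib_left)
  also have "(\<Sum>i\<in>UNIV. \<Sum>j\<in>UNIV. d i + d j) = 2 * N * (\<Sum>i\<in>UNIV. d i)"
    by (simp add: sum.distrib N_def sum_distrib_left sum_distrib_right mult_ac)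
  also have "(- 1 / (2 * N)) * (2 * N * (\<Sum>i\<in>UNIV. d i)) = - (\<Sum>i\<in>UNIV. d i)"
    using N by simp
  finally have "(\<Sum>i\<in>UNIV. \<Sum>j\<in>UNIV. - (d i + d j) / (2 * N)) = - (\<Sum>i\<in>UNIV. d i)" .
  moreover have "(\<Sum>i\<in>UNIV. \<Sum>j\<in>UNIV. - (d i + d j) / (2 * N)) \<le>
      (\<Sum>i\<in>UNIV. \<Sum>j\<in>UNIV. if i = j then 0 else v $ i * (A $ i $ j * v $ j))"
    by (intro sum_mono le)
  moreover have "(\<Sum>i\<in>UNIV. v $ i * (A *v v) $ i) =
      (\<Sum>i\<in>UNIV. \<Sum>j\<in>UNIV. (if i = j then d i else 0) + (if i = j then 0 else v $ i * (A $ i $ j * v $ j)))"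
    unfolding matrix_vector_mult_def
    by (simp add: sum_distrib_left) (intro sum.cong refl, auto simp: d_def power2_eq_square mult_ac)
  moreover have "\<dots> = (\<Sum>i\<in>UNIV. d i) + (\<Sum>i\<in>UNIV. \<Sum>j\<in>UNIV. if i = j then 0 else v $ i * (A $ i $ j * v $ j))"
    by (simp add: sum.distrib)
  ultimately show "0 \<le> (\<Sum>i\<in>UNIV. v $ i * (A *v v) $ i)" by simp
qed (rule sym)

lemma psd_quadratic_form_nonneg:
  fixes A :: "'a::linordered_field ^ 'm ^ 'm"
  assumes "psd A"
  shows "0 \<le> a\<^sup>2 * A $ i $ i + 2 * a * b * A $ i $ j + b\<^sup>2 * A $ j $ j"
proof -
  define v :: "'a ^ 'm" where "v = (\<chi> k. (if k = i then a else 0) + (if k = j then b else 0))"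
  have "transpose A $ i $ j = A $ i $ j" using assms by (simp add: psd_def)
  then have sym: "A $ j $ i = A $ i $ j" by (simp add: transpose_def)
  have "(A *v v) $ k = A $ k $ i * a + A $ k $ j * b" for k
    by (simp add: matrix_vector_mult_def v_def distrib_left sum.distrib if_distrib[of "\<lambda>c. A $ k $ _ * c"] cong: if_cong)
  then have "(\<Sum>k\<in>UNIV. v $ k * (A *v v) $ k) =
      a * (A $ i $ i * a + A $ i $ j * b) + b * (A $ j $ i * a + A $ j $ j * b)"
    by (simp add: v_def distrib_right sum.distrib if_distrib[of "\<lambda>c. c * _"] cong: if_cong)
  moreover have "0 \<le> (\<Sum>k\<in>UNIV. v $ k * (A *v v) $ k)" using assms by (simp add: psd_def)
  ultimately show ?thesis by (simp add: sym power2_eq_square algebra_simps)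
qed

lemma psd_diagonal_nonneg:
  fixes A :: "'a::linordered_field ^ 'm ^ 'm"
  assumes "psd A"
  shows "0 \<le> A $ i $ i"
proof -
  have "0 \<le> (\<Sum>k\<in>UNIV. axis i 1 $ k * (A *v axis i 1) $ k)" using assms by (simp add: psd_def)
  also have "\<dots> = A $ i $ i"
    by (simp add: axis_def matrix_vector_mult_def if_distrib[of "\<lambda>c. c * _"] if_distrib[of "\<lambda>c. _ * c"] cong: if_cong)
  finally show ?thesis .
qed

text \<open>
  Evaluated at the vectors
  \<open>A\<^sub>j\<^sub>j e\<^sub>i - A\<^sub>i\<^sub>j e\<^sub>j\<close> and \<open>A\<^sub>i\<^sub>i e\<^sub>j - A\<^sub>i\<^sub>j e\<^sub>i\<close> the quadratic form is the minor times a
  diagonal entry; the vectors \<open>e\<^sub>i \<plusminus> e\<^sub>j\<close> treat the case in which both diagonal entries are zero.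
\<close>

lemma psd_minor_nonneg:
  fixes A :: "'a::linordered_field ^ 'm ^ 'm"
  assumes psd: "psd A" and ij: "i \<noteq> j"
  shows "(A $ i $ j)\<^sup>2 \<le> A $ i $ i * A $ j $ j"
proof -
  define a b q where "a = A $ i $ i" and "b = A $ j $ j" and "q = A $ i $ j"
  have form: "0 \<le> s\<^sup>2 * a + 2 * s * t * q + t\<^sup>2 * b" for s t
    unfolding a_def b_def q_def using psd by (rule psd_quadratic_form_nonneg)
  have nn: "0 \<le> a" "0 \<le> b" unfolding a_def b_def using psd by (simp_all add: psd_diagonal_nonneg)
  have "0 \<le> b * (a * b - q\<^sup>2)" using form[of b "- q"] by (simp add: power2_eq_square algebra_simps)
  moreover have "0 \<le> a * (a * b - q\<^sup>2)" using form[of "- q" a] by (simp add: power2_eq_square algebra_simps)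
  moreover have "q = 0" if "a = 0" "b = 0" using form[of 1 1] form[of 1 "- 1"] that by simp
  ultimately have "q\<^sup>2 \<le> a * b" using nn by (cases "a = 0"; cases "b = 0") (auto simp: zero_le_mult_iff mult_le_0_iff)
  then show ?thesis by (simp add: a_def b_def q_def)
qed

section \<open>Cancelling linear forms inside a convex set\<close>

text \<open>
  The triples \<open>(a, b, q)\<close> with \<open>a, b \<ge> 0\<close> and \<open>q\<^sup>2 \<le> a * b\<close> form a rotated second-order cone,
  which is convex.
\<close>

lemma square_le_prod_add:
  fixes a b q :: "'a::linordered_field"
  assumes nn: "0 \<le> a" "0 \<le> b" "0 \<le> a'" "0 \<le> b'" and le: "q\<^sup>2 \<le> a * b" "q'\<^sup>2 \<le> a' * b'"
  shows "(q + q')\<^sup>2 \<le> (a + a') * (b + b')"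
proof -
  have "(q * q')\<^sup>2 \<le> (a * b) * (a' * b')"
    using nn le by (simp add: power_mult_distrib mult_mono)
  then have "2 * \<bar>q * q'\<bar> \<le> a * b' + a' * b"
    using nn by (intro two_mult_le_add_if_square_le) (simp_all add: mult_ac)
  then have "2 * (q * q') \<le> a * b' + a' * b" by linarith
  then show ?thesis using le by (simp add: power2_eq_square algebra_simps)
qed

text \<open>
  The forms are made to vanish one after the other. Suppose that for every sign pattern some point
  of \<open>C\<close> has this pattern on the remaining forms and zeros of the forms in \<open>F\<close>. Two such points
  whose patterns differ only at \<open>p\<close> span a segment on which the form with index \<open>p\<close> has a zero,
  while zeros and signs that the two points share persist along the segment.
\<close>

lemma common_zero_if_all_signs:
  fixes f :: "'p \<Rightarrow> 'a::linordered_field ^ 'n \<Rightarrow> 'a"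
  assumes lin: "\<And>p a b y z. f p (a *s y + b *s z) = a * f p y + b * f p z"
    and conv: "\<And>a b y z. y \<in> C \<Longrightarrow> z \<in> C \<Longrightarrow> 0 \<le> a \<Longrightarrow> 0 \<le> b \<Longrightarrow> a + b = 1 \<Longrightarrow> a *s y + b *s z \<in> C"
    and "finite P"
    and signs: "\<And>\<sigma>. \<exists>z\<in>C. \<forall>p\<in>P. if \<sigma> p then 0 \<le> f p z else f p z \<le> 0"
  shows "\<exists>z\<in>C. \<forall>p\<in>P. f p z = 0"
proof -
  have "\<exists>z\<in>C. \<forall>p\<in>P. if p \<in> F then f p z = 0 else if \<sigma> p then 0 \<le> f p z else f p z \<le> 0"
    if "finite F" for F \<sigma>
    using that
  proof (induction F arbitrary: \<sigma> rule: finite_induct)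
    case empty
    show ?case using signs by simp
  next
    case (insert p F)
    obtain y where y: "y \<in> C"
      "\<And>r. r \<in> P \<Longrightarrow> if r \<in> F then f r y = 0 else if (\<sigma>(p := True)) r then 0 \<le> f r y else f r y \<le> 0"
      using insert.IH[of "\<sigma>(p := True)"] by blast
    obtain z where z: "z \<in> C"
      "\<And>r. r \<in> P \<Longrightarrow> if r \<in> F then f r z = 0 else if (\<sigma>(p := False)) r then 0 \<le> f r z else f r z \<le> 0"
      using insert.IH[of "\<sigma>(p := False)"] by blast
    show ?case
    proof (cases "p \<in> P \<and> f p y \<noteq> 0")
      case False
      then show ?thesis using y by (intro bexI[of _ y]) (auto split: if_splits)
    next
      case True
      then have pos: "0 < f p y" "f p z \<le> 0"
        using y(2)[of p] z(2)[of p] insert.hyps by auto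
      \<comment> \<open>the zero of the affine function on the segment from \<open>y\<close> to \<open>z\<close>\<close>
      define D where "D = f p y - f p z"
      define a b where "a = - f p z / D" and "b = f p y / D"
      have D: "0 < D" using pos by (simp add: D_def)
      have ab: "0 \<le> a" "0 \<le> b" "a + b = 1"
        using pos D by (simp_all add: a_def b_def divide_nonpos_pos) (simp add: D_def divide_simps)
      have fp: "a * f p y + b * f p z = 0" by (simp add: a_def b_def mult.commute)
      show ?thesis
      proof (intro bexI[of _ "a *s y + b *s z"] ballI)
        show "a *s y + b *s z \<in> C" using y z ab conv by blast
        fix r assume r: "r \<in> P"
        show "if r \<in> insert p F then f r (a *s y + b *s z) = 0
          else if \<sigma> r then 0 \<le> f r (a *s y + b *s z) else f r (a *s y + b *s z) \<le> 0"
          using y(2)[OF r] z(2)[OF r] ab fp unfolding lin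
          by (auto split: if_splits simp: mult_nonneg_nonneg mult_nonneg_nonpos add_nonpos_nonpos)
      qed
    qed
  qed
  from this[OF \<open>finite P\<close>, of undefined] show ?thesis by auto
qed

section \<open>Formal tropicalization of the principal minors\<close>

definition mpoly_monom :: "('n::finite \<Rightarrow>\<^sub>0 nat) \<Rightarrow> 'a::comm_ring_1 ^ 'n \<Rightarrow> 'a" where
  "mpoly_monom \<alpha> x = (\<Prod>k\<in>UNIV. x $ k ^ Poly_Mapping.lookup \<alpha> k)"

definition mpoly_eval :: "('n::finite, 'a::comm_ring_1) mpoly \<Rightarrow> 'a ^ 'n \<Rightarrow> 'a" where
  "mpoly_eval P x = (\<Sum>\<alpha>\<in>Poly_Mapping.keys P. Poly_Mapping.lookup P \<alpha> * mpoly_monom \<alpha> x)"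

lemma lookup_sum_single:
  "Poly_Mapping.lookup (\<Sum>t\<in>T. Poly_Mapping.single (\<alpha> t) (c t)) \<beta> = (\<Sum>t\<in>T. if \<alpha> t = \<beta> then c t else 0)"
  by (simp add: lookup_sum lookup_single when_def)

lemma mpoly_eval_sum_single:
  assumes "finite T"
  shows "mpoly_eval (\<Sum>t\<in>T. Poly_Mapping.single (\<alpha> t) (c t)) x = (\<Sum>t\<in>T. c t * mpoly_monom (\<alpha> t) x)"
    (is "mpoly_eval ?P x = _")
proof -
  have "mpoly_eval ?P x = (\<Sum>\<beta>\<in>\<alpha> ` T. Poly_Mapping.lookup ?P \<beta> * mpoly_monom \<beta> x)"
    unfolding mpoly_eval_def
  proof (rule sum.mono_neutral_left)
    show "Poly_Mapping.keys ?P \<subseteq> \<alpha> ` T"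
    proof
      fix \<beta> assume "\<beta> \<in> Poly_Mapping.keys ?P"
      then have "(\<Sum>t\<in>T. if \<alpha> t = \<beta> then c t else 0) \<noteq> 0"
        by (simp add: in_keys_iff lookup_sum_single)
      then show "\<beta> \<in> \<alpha> ` T" by (rule contrapos_np) (auto intro!: sum.neutral)
    qed
  qed (use assms in \<open>auto simp: in_keys_iff\<close>)
  also have "\<dots> = (\<Sum>\<beta>\<in>\<alpha> ` T. \<Sum>t\<in>T. if \<alpha> t = \<beta> then c t * mpoly_monom \<beta> x else 0)"
    unfolding lookup_sum_single sum_distrib_right by (intro sum.cong refl) auto
  also have "\<dots> = (\<Sum>t\<in>T. \<Sum>\<beta>\<in>\<alpha> ` T. if \<alpha> t = \<beta> then c t * mpoly_monom \<beta> x else 0)"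
    by (rule sum.swap)
  also have "\<dots> = (\<Sum>t\<in>T. c t * mpoly_monom (\<alpha> t) x)"
    using assms by (intro sum.cong refl) simp
  finally show ?thesis .
qed

lemma val_monom_times:
  "val (Poly_Mapping.lookup P \<alpha> * mpoly_monom \<alpha> z) = trop_monom P \<alpha> (val_vec z)"
  by (simp add: trop_monom_def mpoly_monom_def val_vec_def val_mult val_prod val_power)

lemma mpoly_monom_nonneg:
  fixes z :: "'a::linordered_field ^ 'n"
  shows "(\<And>k. 0 \<le> z $ k) \<Longrightarrow> 0 \<le> mpoly_monom \<alpha> z"
  by (simp add: mpoly_monom_def prod_nonneg)

text \<open>
  The absolute value of each negative term is at most the sum of the positive terms, and the
  valuation of that sum is bounded by the valuation of one of them.
\<close>

lemma ftrop_minus_le_plus_if_eval_nonneg: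
  fixes P :: "('n::finite, puiseux) mpoly"
  assumes "0 \<le> mpoly_eval P z" and z: "\<And>k. 0 \<le> z $ k"
  shows "ftrop_minus P (val_vec z) \<le> ftrop_plus P (val_vec z)"
  unfolding ftrop_minus_def
proof (rule SUP_least)
  fix \<alpha> assume "\<alpha> \<in> {\<alpha>. Poly_Mapping.lookup P \<alpha> < 0}"
  then have \<alpha>: "Poly_Mapping.lookup P \<alpha> < 0" by simp
  define t where "t \<beta> = Poly_Mapping.lookup P \<beta> * mpoly_monom \<beta> z" for \<beta>
  have val_t: "val (t \<beta>) = trop_monom P \<beta> (val_vec z)" for \<beta>
    by (simp add: t_def val_monom_times)
  have m: "0 \<le> mpoly_monom \<beta> z" for \<beta> using z by (rule mpoly_monom_nonneg)
  show "trop_monom P \<alpha> (val_vec z) \<le> ftrop_plus P (val_vec z)"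
  proof (cases "t \<alpha> = 0")
    case True
    then have "trop_monom P \<alpha> (val_vec z) = -\<infinity>" using val_t[of \<alpha>] by simp
    then show ?thesis by simp
  next
    case False
    have neg: "t \<alpha> \<le> 0" unfolding t_def using \<alpha> m[of \<alpha>] by (simp add: mult_nonpos_nonneg)
    define A where "A = {\<beta> \<in> Poly_Mapping.keys P. 0 < Poly_Mapping.lookup P \<beta>}"
    have fin: "finite A" by (simp add: A_def)
    have in_keys: "\<alpha> \<in> Poly_Mapping.keys P" using \<alpha> by (simp add: in_keys_iff)
    have nonpos: "t \<beta> \<le> 0" if "\<beta> \<in> Poly_Mapping.keys P - A - {\<alpha>}" for \<beta>
      unfolding t_def using that m[of \<beta>] by (auto simp: A_def not_less mult_nonpos_nonneg)
    have "mpoly_eval P z = sum t A + sum t (Poly_Mapping.keys P - A)"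
      unfolding mpoly_eval_def t_def by (subst sum.subset_diff[of A]) (auto simp: A_def)
    also have "sum t (Poly_Mapping.keys P - A) = t \<alpha> + sum t (Poly_Mapping.keys P - A - {\<alpha>})"
      using in_keys \<alpha> by (intro sum.remove) (auto simp: A_def)
    also have "sum t (Poly_Mapping.keys P - A - {\<alpha>}) \<le> 0"
      using nonpos by (rule sum_nonpos)
    finally have le: "- t \<alpha> \<le> sum t A" using assms(1) by simp
    then have "0 < sum t A" using neg False by simp
    then obtain \<beta> where \<beta>: "\<beta> \<in> A" "val (sum t A) \<le> val (t \<beta>)"
      using val_sum_pos_le[OF fin] by blast
    have "val (t \<alpha>) = val (- t \<alpha>)" by simp
    also have "\<dots> \<le> val (sum t A)" using le neg by (intro val_mono) auto
    also have "\<dots> \<le> val (t \<beta>)" by (rule \<beta>)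
    also have "\<dots> \<le> ftrop_plus P (val_vec z)"
      unfolding val_t ftrop_plus_def using \<beta>(1) by (intro SUP_upper) (simp add: A_def)
    finally show ?thesis by (simp add: val_t)
  qed
qed

abbreviation unit_exp :: "'n \<Rightarrow> 'n \<Rightarrow>\<^sub>0 nat" where
  "unit_exp k \<equiv> Poly_Mapping.single k (Suc 0)"

lemma unit_exp_inject: "unit_exp k = unit_exp l \<longleftrightarrow> k = l"
proof
  assume "unit_exp k = unit_exp l"
  then have "Poly_Mapping.lookup (unit_exp k) k = Poly_Mapping.lookup (unit_exp l) k" by simp
  then show "k = l" by (simp add: lookup_single when_def split: if_splits)
qed simp

lemma entry_poly_eq:
  "entry_poly Q i j = (\<Sum>k\<in>UNIV. Poly_Mapping.single (unit_exp k) (Q k $ i $ j))"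
  by (simp add: entry_poly_def Var_def Const_def mult_single)

text \<open>
  Each monomial \<open>X\<^sub>k X\<^sub>l\<close> with \<open>k \<noteq> l\<close> arises from two index pairs, and its coefficient may suffer
  cancellation. Therefore the expansion is kept indexed by pairs instead of by monomials.
\<close>

lemma minor_poly_eq:
  fixes Q :: "'n::finite \<Rightarrow> 'a::comm_ring_1 ^ 'm ^ 'm"
  shows "minor_poly Q i j = (\<Sum>(k, l)\<in>UNIV. Poly_Mapping.single (unit_exp k + unit_exp l)
     (Q k $ i $ i * Q l $ j $ j - Q k $ i $ j * Q l $ i $ j))"
proof -
  have "(\<Sum>k\<in>UNIV. Poly_Mapping.single (unit_exp k) (a k)) * (\<Sum>k\<in>UNIV. Poly_Mapping.single (unit_exp k) (b k)) =
      (\<Sum>(k, l)\<in>UNIV. Poly_Mapping.single (unit_exp k + unit_exp l) (a k * b l))" for a b :: "'n \<Rightarrow> 'a"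
    by (simp add: sum_product mult_single sum.cartesian_product)
  then show ?thesis
    by (simp add: minor_poly_def entry_poly_eq power2_eq_square single_diff case_prod_beta flip: sum_subtractf)
qed

lemma mpoly_monom_unit: "mpoly_monom (unit_exp k) x = x $ k"
proof -
  have "mpoly_monom (unit_exp k) x = (\<Prod>l\<in>UNIV. if k = l then x $ l else 1)"
    unfolding mpoly_monom_def by (intro prod.cong refl) (simp add: lookup_single when_def)
  then show ?thesis by simp
qed

lemma mpoly_monom_add: "mpoly_monom (\<alpha> + \<beta>) x = mpoly_monom \<alpha> x * mpoly_monom \<beta> x"
  by (simp add: mpoly_monom_def lookup_add power_add prod.distrib)

lemma mpoly_eval_entry: "mpoly_eval (entry_poly Q i j) x = pencil Q x $ i $ j"
  by (simp add: entry_poly_eq mpoly_eval_sum_single mpoly_monom_unit pencil_def mult.commute)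

lemma mpoly_eval_minor:
  fixes Q :: "'n::finite \<Rightarrow> 'a::comm_ring_1 ^ 'm ^ 'm"
  shows "mpoly_eval (minor_poly Q i j) x =
     pencil Q x $ i $ i * pencil Q x $ j $ j - (pencil Q x $ i $ j)\<^sup>2"
proof -
  have prod: "(\<Sum>k\<in>UNIV. x $ k * a k) * (\<Sum>k\<in>UNIV. x $ k * b k) =
      (\<Sum>(k, l)\<in>UNIV. a k * b l * (x $ k * x $ l))" for a b :: "'n \<Rightarrow> 'a"
    unfolding sum_product sum.cartesian_product UNIV_Times_UNIV
    by (intro sum.cong refl) (auto simp: mult_ac)
  have "mpoly_eval (minor_poly Q i j) x =
      (\<Sum>(k, l)\<in>UNIV. (Q k $ i $ i * Q l $ j $ j - Q k $ i $ j * Q l $ i $ j) * (x $ k * x $ l))"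
    unfolding minor_poly_eq case_prod_beta
    by (subst mpoly_eval_sum_single) (simp_all add: mpoly_monom_add mpoly_monom_unit)
  also have "\<dots> = (\<Sum>(k, l)\<in>UNIV. Q k $ i $ i * Q l $ j $ j * (x $ k * x $ l)) -
      (\<Sum>(k, l)\<in>UNIV. Q k $ i $ j * Q l $ i $ j * (x $ k * x $ l))"
    unfolding case_prod_beta left_diff_distrib sum_subtractf ..
  finally show ?thesis
    unfolding prod[symmetric] by (simp add: pencil_def power2_eq_square)
qed

section \<open>Tropical linear forms\<close>

text \<open>
  This is \<open>q\<^sup>+\<close> for the linear form with coefficients \<open>q\<close>; applied to \<open>- q\<close> it gives \<open>q\<^sup>-\<close>, so that
  statements about the two signs need only one proof.
\<close>

definition trop_plus :: "('n::finite \<Rightarrow> puiseux) \<Rightarrow> ereal ^ 'n \<Rightarrow> ereal" where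
  "trop_plus q x = (SUP k\<in>{k. 0 < q k}. val (q k) + x $ k)"

lemma sval_in_trop_pos_iff: "sval a \<in> trop_pos \<longleftrightarrow> 0 < a"
  by (auto simp: sval_def trop_pos_def val_def)

lemma sval_in_trop_neg_iff: "sval a \<in> trop_neg \<longleftrightarrow> a < 0"
  by (auto simp: sval_def trop_neg_def val_def)

lemma modulus_sval: "modulus (sval a) = val a"
  by (simp add: modulus_def sval_def)

lemma sval_mats_entry: "sval_mats Q k $ i $ j = sval (Q k $ i $ j)"
  by (simp add: sval_mats_def map_matrix_def)

lemma Qplus_eq: "Qplus (sval_mats Q) i j = trop_plus (\<lambda>k. Q k $ i $ j)"
  by (simp add: Qplus_def trop_plus_def sval_mats_entry sval_in_trop_pos_iff modulus_sval fun_eq_iff)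

lemma Qminus_eq: "Qminus (sval_mats Q) i j = trop_plus (\<lambda>k. - Q k $ i $ j)"
  by (simp add: Qminus_def trop_plus_def sval_mats_entry sval_in_trop_neg_iff modulus_sval fun_eq_iff)

lemma trop_plus_upper: "0 < q k \<Longrightarrow> val (q k) + x $ k \<le> trop_plus q x"
  unfolding trop_plus_def by (intro SUP_upper) simp

lemma term_le_trop_plus:
  assumes "x \<in> trop_space"
  shows "val (q k) + x $ k \<le> max (trop_plus q x) (trop_plus (\<lambda>k. - q k) x)"
proof (cases "q k" "0 :: puiseux" rule: linorder_cases)
  case less
  then show ?thesis using trop_plus_upper[of "\<lambda>k. - q k" k x] by (simp add: le_max_iff_disj)
next
  case equal
  then have eq: "val (q k) + x $ k = -\<infinity>" using assms by (simp add: trop_space_def)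
  show ?thesis unfolding eq by simp
next
  case greater
  then show ?thesis using trop_plus_upper[of q k x] by (simp add: le_max_iff_disj)
qed

lemma trop_plus_attained:
  assumes "trop_plus q x \<noteq> -\<infinity>"
  obtains k where "0 < q k" "trop_plus q x = val (q k) + x $ k"
proof -
  have ne: "{k. 0 < q k} \<noteq> {}"
  proof
    assume "{k. 0 < q k} = {}"
    then show False using assms by (simp only: trop_plus_def image_empty) (simp add: bot_ereal_def)
  qed
  have "trop_plus q x = Max ((\<lambda>k. val (q k) + x $ k) ` {k. 0 < q k})"
    unfolding trop_plus_def using ne by (simp add: Max_Sup)
  also have "\<dots> \<in> (\<lambda>k. val (q k) + x $ k) ` {k. 0 < q k}"
    using ne by (intro Max_in) auto
  finally show ?thesis using that by auto
qed

lemma trop_plus_neq_PInf: "x \<in> trop_space \<Longrightarrow> trop_plus q x \<noteq> \<infinity>"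
  by (cases "trop_plus q x = -\<infinity>") (auto simp: trop_space_def elim: trop_plus_attained)

lemma sum_unit_exp: "(\<Sum>l\<in>UNIV. ereal (real (Poly_Mapping.lookup (unit_exp k) l)) * x $ l) = x $ k"
proof -
  have "ereal (real (Poly_Mapping.lookup (unit_exp k) l)) * x $ l = (if k = l then x $ l else 0)" for l
    by (simp add: lookup_single when_def flip: zero_ereal_def one_ereal_def)
  then show ?thesis by (simp only: sum.delta' finite UNIV_I if_True)
qed

lemma sum_unit_exp_add:
  "(\<Sum>m\<in>UNIV. ereal (real (Poly_Mapping.lookup (unit_exp k + unit_exp l) m)) * x $ m) = x $ k + x $ l"
proof -
  have "ereal (real (a + b)) * y = ereal (real a) * y + ereal (real b) * y" for a b y
    by (simp add: ereal_left_distrib flip: plus_ereal.simps(1))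
  then show ?thesis by (simp only: lookup_add sum.distrib sum_unit_exp)
qed

lemma entry_coeff_unit: "Poly_Mapping.lookup (entry_poly Q i j) (unit_exp k) = Q k $ i $ j"
  by (simp add: entry_poly_eq lookup_sum_single unit_exp_inject)

lemma entry_coeff_nonzero:
  assumes "Poly_Mapping.lookup (entry_poly Q i j) \<alpha> \<noteq> 0"
  shows "\<exists>k. \<alpha> = unit_exp k"
proof -
  have "(\<Sum>k\<in>UNIV. if unit_exp k = \<alpha> then Q k $ i $ j else 0) \<noteq> 0"
    using assms by (simp add: entry_poly_eq lookup_sum_single)
  then show ?thesis by (rule contrapos_np) (auto intro!: sum.neutral)
qed

lemma trop_monom_entry:
  "trop_monom (entry_poly Q i j) (unit_exp k) x = val (Q k $ i $ j) + x $ k"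
  unfolding trop_monom_def entry_coeff_unit sum_unit_exp ..

lemma ftrop_plus_entry: "ftrop_plus (entry_poly Q i j) x = trop_plus (\<lambda>k. Q k $ i $ j) x"
proof -
  have "{\<alpha>. 0 < Poly_Mapping.lookup (entry_poly Q i j) \<alpha>} = unit_exp ` {k. 0 < Q k $ i $ j}"
    (is "?L = ?R")
  proof (intro equalityI subsetI)
    fix \<alpha> assume "\<alpha> \<in> ?L"
    then show "\<alpha> \<in> ?R"
      using entry_coeff_nonzero[of Q i j \<alpha>] by (auto simp: entry_coeff_unit)
  qed (auto simp: entry_coeff_unit)
  then show ?thesis
    by (simp add: ftrop_plus_def trop_plus_def image_image trop_monom_entry)
qed

lemma ftrop_minus_entry: "ftrop_minus (entry_poly Q i j) x = trop_plus (\<lambda>k. - Q k $ i $ j) x"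
proof -
  have "{\<alpha>. Poly_Mapping.lookup (entry_poly Q i j) \<alpha> < 0} = unit_exp ` {k. Q k $ i $ j < 0}"
    (is "?L = ?R")
  proof (intro equalityI subsetI)
    fix \<alpha> assume "\<alpha> \<in> ?L"
    then show "\<alpha> \<in> ?R"
      using entry_coeff_nonzero[of Q i j \<alpha>] by (auto simp: entry_coeff_unit)
  qed (auto simp: entry_coeff_unit)
  then show ?thesis
    by (simp add: ftrop_minus_def trop_plus_def image_image trop_monom_entry)
qed

section \<open>Tropical consequences of the minor inequalities\<close>

lemma unit_exp_add_self_iff:
  "unit_exp a + unit_exp b = unit_exp k + unit_exp k \<longleftrightarrow> a = k \<and> b = k"
proof
  assume eq: "unit_exp a + unit_exp b = unit_exp k + unit_exp k"
  have "Poly_Mapping.lookup (unit_exp a + unit_exp b) m = Poly_Mapping.lookup (unit_exp k + unit_exp k) m" for m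
    by (simp only: eq)
  from this[of a] this[of b] show "a = k \<and> b = k"
    by (auto simp: lookup_add lookup_single when_def split: if_splits)
qed simp

lemma minor_coeff:
  "Poly_Mapping.lookup (minor_poly Q i j) \<alpha> = (\<Sum>(k, l)\<in>UNIV. if unit_exp k + unit_exp l = \<alpha>
     then Q k $ i $ i * Q l $ j $ j - Q k $ i $ j * Q l $ i $ j else 0)"
  unfolding minor_poly_eq case_prod_beta lookup_sum_single ..

text \<open>
  The monomials \<open>X\<^sub>k\<^sup>2\<close> arise from a single index pair; these are the ones whose coefficients can be
  bounded from below.
\<close>

lemma minor_coeff_square:
  "Poly_Mapping.lookup (minor_poly Q i j) (unit_exp k + unit_exp k) =
     Q k $ i $ i * Q k $ j $ j - (Q k $ i $ j)\<^sup>2"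
proof -
  have "Poly_Mapping.lookup (minor_poly Q i j) (unit_exp k + unit_exp k) =
      (\<Sum>p\<in>UNIV. if p = (k, k) then Q k $ i $ i * Q k $ j $ j - (Q k $ i $ j)\<^sup>2 else 0)"
    unfolding minor_coeff by (intro sum.cong refl) (auto simp: unit_exp_add_self_iff power2_eq_square split: if_splits)
  then show ?thesis by simp
qed

text \<open>
  A positive coefficient need not come from one product, but its valuation is at most that of one
  of the products that contribute positively to it.
\<close>

lemma minor_coeff_pos:
  fixes Q :: "'n::finite \<Rightarrow> puiseux ^ 'm ^ 'm"
  assumes pos: "0 < Poly_Mapping.lookup (minor_poly Q i j) \<alpha>" (is "0 < ?c")
  obtains k l where "\<alpha> = unit_exp k + unit_exp l"
    "val ?c \<le> val (Q k $ i $ i) + val (Q l $ j $ j) \<or>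
     Q k $ i $ j * Q l $ i $ j < 0 \<and> val ?c \<le> val (Q k $ i $ j) + val (Q l $ i $ j)"
proof -
  define c where "c = (\<lambda>(k, l). if unit_exp k + unit_exp l = \<alpha>
     then Q k $ i $ i * Q l $ j $ j - Q k $ i $ j * Q l $ i $ j else 0)"
  have c_eq: "?c = sum c UNIV" unfolding minor_coeff c_def ..
  have "finite (UNIV :: ('n \<times> 'n) set)" by simp
  from val_sum_pos_le[OF this pos[unfolded c_eq]]
  obtain p where p: "0 < c p" "val (sum c UNIV) \<le> val (c p)" by blast
  obtain k l where kl: "p = (k, l)" by (cases p)
  have \<alpha>: "unit_exp k + unit_exp l = \<alpha>" using p(1) by (auto simp: c_def kl split: if_splits)
  then have cp: "c p = Q k $ i $ i * Q l $ j $ j + - (Q k $ i $ j * Q l $ i $ j)"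
    by (simp add: c_def kl)
  have "val (c p) \<le> val (Q k $ i $ i * Q l $ j $ j) \<or>
      0 < - (Q k $ i $ j * Q l $ i $ j) \<and> val (c p) \<le> val (- (Q k $ i $ j * Q l $ i $ j))"
    using val_add_pos_le[of "Q k $ i $ i * Q l $ j $ j" "- (Q k $ i $ j * Q l $ i $ j)"] p(1)
    unfolding cp by blast
  then have "val ?c \<le> val (Q k $ i $ i) + val (Q l $ j $ j) \<or>
     Q k $ i $ j * Q l $ i $ j < 0 \<and> val ?c \<le> val (Q k $ i $ j) + val (Q l $ i $ j)"
    using p(2) unfolding c_eq val_uminus val_mult by auto
  then show ?thesis using that \<alpha> by blast
qed

text \<open>
  Otherwise let the \<open>k\<close>-th term dominate \<open>Q\<^sub>i\<^sub>j\<close>. The coefficient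
  \<open>Q\<^sub>i\<^sub>i\<^sup>(\<^sup>k\<^sup>) Q\<^sub>j\<^sub>j\<^sup>(\<^sup>k\<^sup>) - (Q\<^sub>i\<^sub>j\<^sup>(\<^sup>k\<^sup>))\<^sup>2\<close> of \<open>X\<^sub>k\<^sup>2\<close> is then negative with valuation twice that of
  \<open>Q\<^sub>i\<^sub>j\<^sup>(\<^sup>k\<^sup>)\<close>. Every positive term of the minor is smaller at \<open>x\<close>: it is bounded either by
  a product of diagonal terms or by a product of two terms of \<open>Q\<^sub>i\<^sub>j\<close> of opposite signs.
\<close>

lemma offdiagonal_condition_if_minor:
  fixes Q :: "'n::finite \<Rightarrow> puiseux ^ 'm ^ 'm"
  assumes x: "x \<in> trop_space"
    and di: "trop_plus (\<lambda>k. - Q k $ i $ i) x \<le> trop_plus (\<lambda>k. Q k $ i $ i) x"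
    and dj: "trop_plus (\<lambda>k. - Q k $ j $ j) x \<le> trop_plus (\<lambda>k. Q k $ j $ j) x"
    and minor: "ftrop_minus (minor_poly Q i j) x \<le> ftrop_plus (minor_poly Q i j) x"
  shows "trop_plus (\<lambda>k. Q k $ i $ j) x = trop_plus (\<lambda>k. - Q k $ i $ j) x \<or>
    2 * max (trop_plus (\<lambda>k. Q k $ i $ j) x) (trop_plus (\<lambda>k. - Q k $ i $ j) x)
      \<le> trop_plus (\<lambda>k. Q k $ i $ i) x + trop_plus (\<lambda>k. Q k $ j $ j) x"
proof (rule ccontr)
  define p m where "p = trop_plus (\<lambda>k. Q k $ i $ j) x" and "m = trop_plus (\<lambda>k. - Q k $ i $ j) x"
  define D where "D = trop_plus (\<lambda>k. Q k $ i $ i) x + trop_plus (\<lambda>k. Q k $ j $ j) x"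
  assume "\<not> ?thesis"
  then have neq: "p \<noteq> m" and less: "D < 2 * max p m" by (auto simp: p_def m_def D_def)
  have fin: "p \<noteq> \<infinity>" "m \<noteq> \<infinity>" unfolding p_def m_def using x by (simp_all add: trop_plus_neq_PInf)
  have "max p m \<noteq> \<infinity>" "max p m \<noteq> -\<infinity>" using fin neq by (auto simp: max_def split: if_splits)
  then obtain \<mu> where \<mu>: "max p m = ereal \<mu>" by (cases "max p m") auto
  \<comment> \<open>two terms of opposite signs contribute at most \<open>p + m\<close>, which is strictly below twice the
    maximum because \<open>p\<close> and \<open>m\<close> differ\<close>
  have lt: "a + b < 2 * b" if "a < b" "b \<noteq> \<infinity>" for a b :: ereal
    using that by (cases a; cases b) auto
  have pm: "p + m < 2 * max p m"
  proof (cases "p < m")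
    case True
    then show ?thesis using lt[OF True fin(2)] by (simp add: max_absorb2)
  next
    case False
    then have "m < p" using neq by simp
    then show ?thesis using lt[OF _ fin(1)] by (simp add: max_absorb1 add.commute)
  qed
  have term_i: "val (Q k $ i $ i) + x $ k \<le> trop_plus (\<lambda>k. Q k $ i $ i) x" for k
    using term_le_trop_plus[OF x, of "\<lambda>k. Q k $ i $ i" k] di by (simp add: max_absorb1)
  have term_j: "val (Q k $ j $ j) + x $ k \<le> trop_plus (\<lambda>k. Q k $ j $ j) x" for k
    using term_le_trop_plus[OF x, of "\<lambda>k. Q k $ j $ j" k] dj by (simp add: max_absorb1)
  have "ftrop_plus (minor_poly Q i j) x \<le> max D (p + m)"
    unfolding ftrop_plus_def
  proof (rule SUP_least)
    fix \<alpha> assume "\<alpha> \<in> {\<alpha>. 0 < Poly_Mapping.lookup (minor_poly Q i j) \<alpha>}"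
    then have "0 < Poly_Mapping.lookup (minor_poly Q i j) \<alpha>" (is "0 < ?c") by simp
    then obtain k l where \<alpha>: "\<alpha> = unit_exp k + unit_exp l"
      and cases: "val ?c \<le> val (Q k $ i $ i) + val (Q l $ j $ j) \<or>
        Q k $ i $ j * Q l $ i $ j < 0 \<and> val ?c \<le> val (Q k $ i $ j) + val (Q l $ i $ j)"
      by (rule minor_coeff_pos)
    have tm: "trop_monom (minor_poly Q i j) \<alpha> x = val ?c + (x $ k + x $ l)"
      unfolding trop_monom_def by (simp only: \<alpha> sum_unit_exp_add)
    show "trop_monom (minor_poly Q i j) \<alpha> x \<le> max D (p + m)"
      using cases
    proof
      assume "val ?c \<le> val (Q k $ i $ i) + val (Q l $ j $ j)"
      then have "trop_monom (minor_poly Q i j) \<alpha> x \<le> val (Q k $ i $ i) + val (Q l $ j $ j) + (x $ k + x $ l)"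
        unfolding tm by (rule add_right_mono)
      also have "\<dots> = (val (Q k $ i $ i) + x $ k) + (val (Q l $ j $ j) + x $ l)" by (simp add: ac_simps)
      also have "\<dots> \<le> D" unfolding D_def by (intro add_mono term_i term_j)
      finally show ?thesis by (simp add: le_max_iff_disj)
    next
      assume asm: "Q k $ i $ j * Q l $ i $ j < 0 \<and> val ?c \<le> val (Q k $ i $ j) + val (Q l $ i $ j)"
      then have "trop_monom (minor_poly Q i j) \<alpha> x \<le> val (Q k $ i $ j) + val (Q l $ i $ j) + (x $ k + x $ l)"
        unfolding tm by (intro add_right_mono) simp
      also have "\<dots> = (val (Q k $ i $ j) + x $ k) + (val (Q l $ i $ j) + x $ l)" by (simp add: ac_simps)
      also have "\<dots> \<le> p + m"
      proof (cases "0 < Q k $ i $ j")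
        case True
        then have "0 < - Q l $ i $ j" using asm by (auto simp: mult_less_0_iff)
        then show ?thesis
          using True trop_plus_upper[of "\<lambda>k. Q k $ i $ j" k x] trop_plus_upper[of "\<lambda>k. - Q k $ i $ j" l x]
          unfolding p_def m_def by (intro add_mono) simp_all
      next
        case False
        then have "0 < - Q k $ i $ j" "0 < Q l $ i $ j" using asm by (auto simp: mult_less_0_iff)
        then show ?thesis
          using trop_plus_upper[of "\<lambda>k. Q k $ i $ j" l x] trop_plus_upper[of "\<lambda>k. - Q k $ i $ j" k x]
          unfolding p_def m_def by (subst add.commute) (intro add_mono, simp_all)
      qed
      finally show ?thesis by (simp add: le_max_iff_disj)
    qed
  qed
  then have upper: "ftrop_plus (minor_poly Q i j) x < 2 * max p m"
    using less pm by (metis le_less_trans max_less_iff_conj)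
  obtain k where k: "val (Q k $ i $ j) + x $ k = max p m"
  proof (cases "p < m")
    case True
    then have "m \<noteq> -\<infinity>" by auto
    then obtain k where "m = val (- Q k $ i $ j) + x $ k"
      unfolding m_def by (rule trop_plus_attained)
    then show ?thesis using that[of k] True by (simp only: val_uminus max_absorb2 less_imp_le)
  next
    case False
    then have "m < p" using neq by simp
    then have "p \<noteq> -\<infinity>" by auto
    then obtain k where "p = val (Q k $ i $ j) + x $ k"
      unfolding p_def by (rule trop_plus_attained)
    then show ?thesis using that[of k] \<open>m < p\<close> by (simp only: max_absorb1 less_imp_le)
  qed
  obtain v \<xi> where v: "val (Q k $ i $ j) = ereal v" and \<xi>: "x $ k = ereal \<xi>" and "v + \<xi> = \<mu>"
    using k unfolding \<mu> by (cases "val (Q k $ i $ j)"; cases "x $ k") auto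
  have "val (Q k $ i $ i * Q k $ j $ j) + ereal (2 * \<xi>) =
      (val (Q k $ i $ i) + x $ k) + (val (Q k $ j $ j) + x $ k)"
    unfolding val_mult \<xi> by (cases "val (Q k $ i $ i)"; cases "val (Q k $ j $ j)") auto
  also have "\<dots> \<le> D" unfolding D_def by (intro add_mono term_i term_j)
  also have "\<dots> < ereal (2 * \<mu>)" using less by (simp add: \<mu>)
  finally have vless: "val (Q k $ i $ i * Q k $ j $ j) < val ((Q k $ i $ j)\<^sup>2)"
    using \<open>v + \<xi> = \<mu>\<close> unfolding power2_eq_square val_mult[of "Q k $ i $ j"] v
    by (cases "val (Q k $ i $ i * Q k $ j $ j)") auto
  define c where "c = Poly_Mapping.lookup (minor_poly Q i j) (unit_exp k + unit_exp k)"
  have c: "c = - ((Q k $ i $ j)\<^sup>2 - Q k $ i $ i * Q k $ j $ j)"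
    unfolding c_def minor_coeff_square by simp
  have "c < 0" using less_if_val_less[OF _ vless] by (simp add: c)
  then have "trop_monom (minor_poly Q i j) (unit_exp k + unit_exp k) x \<le> ftrop_minus (minor_poly Q i j) x"
    unfolding ftrop_minus_def c_def by (intro SUP_upper) simp
  moreover have "2 * max p m \<le> trop_monom (minor_poly Q i j) (unit_exp k + unit_exp k) x"
  proof -
    have "ereal (2 * v) = val ((Q k $ i $ j)\<^sup>2)" by (simp add: power2_eq_square val_mult v)
    also have "\<dots> \<le> val c" using val_diff_ge[OF _ vless] unfolding c val_uminus by simp
    finally have "ereal (2 * v) + ereal (2 * \<xi>) \<le> val c + (x $ k + x $ k)"
      unfolding \<xi> by (intro add_mono) simp_all
    moreover have "2 * max p m = ereal (2 * v) + ereal (2 * \<xi>)"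
      using \<open>v + \<xi> = \<mu>\<close> by (simp add: \<mu>)
    ultimately show ?thesis
      unfolding trop_monom_def c_def[symmetric] sum_unit_exp_add by (simp only:)
  qed
  ultimately show False using minor upper by simp
qed

section \<open>Generic points near a point of a regular set\<close>

text \<open>
  The difference of the exponents of \<open>z\<^sub>k z\<^sub>l\<close> and \<open>z\<^sub>q\<^sup>2\<close>. The diagonal product is compared with
  the square of an off-diagonal term by means of these forms, and two terms of the same linear form
  by means of their squares, that is, with \<open>k = l\<close>. The form is identically zero only
  for \<open>k = q = l\<close>.
\<close>

definition comparison :: "'n \<times> 'n \<times> 'n \<Rightarrow> ('n \<Rightarrow> real) \<Rightarrow> real" where
  "comparison = (\<lambda>(k, l, q) y. y k + y l - 2 * y q)"

lemma continuous_map_comparison: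
  assumes "k \<in> K" "l \<in> K" "q \<in> K"
  shows "continuous_map (powertop_real K) euclideanreal (\<lambda>y. c + comparison (k, l, q) y)"
  unfolding comparison_def case_prod_conv
  by (intro continuous_map_add continuous_map_diff continuous_map_real_mult_left continuous_map_canonical_const
      continuous_map_product_projection assms)

lemma comparison_shift:
  assumes "\<not> (k = q \<and> l = q)" "e \<noteq> 0" "comparison (k, l, q) y = r"
  shows "comparison (k, l, q) (y(q := y q + e)) \<noteq> r"
  using assms by (auto simp: comparison_def)

text \<open>
  A nonconstant affine form vanishes on no nonempty open set: moving the coordinate with index \<open>q\<close>, in which the
  coefficient of the form is not zero, leaves the zero set at once.
\<close>

lemma open_avoids_comparison_zero:
  assumes W: "openin (powertop_real K) W" "W \<noteq> {}"
    and klq: "k \<in> K" "l \<in> K" "q \<in> K" "\<not> (k = q \<and> l = q)"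
  shows "openin (powertop_real K) {y \<in> W. c + comparison (k, l, q) y \<noteq> 0}"
    "{y \<in> W. c + comparison (k, l, q) y \<noteq> 0} \<noteq> {}"
proof -
  have top: "W \<subseteq> topspace (powertop_real K)" using W(1) by (rule openin_subset)
  have "openin (powertop_real K) {y \<in> topspace (powertop_real K). c + comparison (k, l, q) y \<in> - {0}}"
    using klq by (intro openin_continuous_map_preimage[OF continuous_map_comparison]) auto
  then have "openin (powertop_real K) (W \<inter> {y \<in> topspace (powertop_real K). c + comparison (k, l, q) y \<in> - {0}})"
    using W(1) by (intro openin_Int)
  also have "W \<inter> {y \<in> topspace (powertop_real K). c + comparison (k, l, q) y \<in> - {0}} =
      {y \<in> W. c + comparison (k, l, q) y \<noteq> 0}"
    using top by auto
  finally show "openin (powertop_real K) {y \<in> W. c + comparison (k, l, q) y \<noteq> 0}" .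
  obtain y where y: "y \<in> W" using W(2) by blast
  show "{y \<in> W. c + comparison (k, l, q) y \<noteq> 0} \<noteq> {}"
  proof (cases "c + comparison (k, l, q) y = 0")
    case True
    have "continuous_map euclideanreal (powertop_real K) (\<lambda>e. y(q := y q + e))"
      unfolding continuous_map_componentwise
    proof (intro conjI ballI)
      show "(\<lambda>e. y(q := y q + e)) ` topspace euclideanreal \<subseteq> extensional K"
        using y top klq(3) by (force simp: extensional_def PiE_def)
      show "continuous_map euclideanreal euclideanreal (\<lambda>e. (y(q := y q + e)) r)" for r
        by (cases "r = q") (auto intro!: continuous_intros)
    qed
    from openin_continuous_map_preimage[OF this W(1)]
    have "open {e. y(q := y q + e) \<in> W}" by simp
    moreover have "0 \<in> {e. y(q := y q + e) \<in> W}" using y by simp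
    ultimately obtain d where d: "0 < d" "ball 0 d \<subseteq> {e. y(q := y q + e) \<in> W}"
      by (meson open_contains_ball)
    have "y(q := y q + d / 2) \<in> W" using d by (auto simp: subset_iff)
    moreover have "c + comparison (k, l, q) (y(q := y q + d / 2)) \<noteq> 0"
      using comparison_shift[OF klq(4), of "d / 2" y "- c"] d(1) True by (auto simp: add_eq_0_iff)
    ultimately show ?thesis by blast
  qed (use y in blast)
qed

lemma open_avoids_finitely_many_comparison_zeros:
  assumes "openin (powertop_real K) W" "W \<noteq> {}" "finite T"
    and "\<And>c k l q. (c, k, l, q) \<in> T \<Longrightarrow> k \<in> K \<and> l \<in> K \<and> q \<in> K \<and> \<not> (k = q \<and> l = q)"
  shows "\<exists>y\<in>W. \<forall>(c, t)\<in>T. c + comparison t y \<noteq> 0"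
  using assms(3,1,2,4)
proof (induction T arbitrary: W rule: finite_induct)
  case empty
  then show ?case by auto
next
  case (insert p T)
  obtain c k l q where p: "p = (c, k, l, q)" by (rule prod_cases4)
  let ?W = "{y \<in> W. c + comparison (k, l, q) y \<noteq> 0}"
  have "\<exists>y\<in>?W. \<forall>(c, t)\<in>T. c + comparison t y \<noteq> 0"
  proof (rule insert.IH)
    have "k \<in> K" "l \<in> K" "q \<in> K" "\<not> (k = q \<and> l = q)"
      using insert.prems(3)[of c k l q] p by simp_all
    note avoid = open_avoids_comparison_zero[OF insert.prems(1,2) this]
    show "openin (powertop_real K) ?W" "?W \<noteq> {}" by (rule avoid)+
  qed (intro insert.prems(3) insertI2)
  then show ?case using p by auto
qed

text \<open>
  A regular set is the closure of its interior, so each neighbourhood of \<open>x\<close> contains a nonempty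
  open subset of \<open>S\<close>, and such a set is not covered by finitely many hyperplanes. The first
  conclusion says that \<open>y\<close> is close to \<open>x\<close>, in the only respect that matters later: strict
  inequalities between terms at \<open>x\<close> are preserved.
\<close>

lemma regular_generic_approximation:
  fixes K :: "'n::finite set"
  assumes "regular_in K S" "x \<in> S" "finite C"
  shows "\<exists>y\<in>S. \<forall>c\<in>C. \<forall>k\<in>K. \<forall>l\<in>K. \<forall>q\<in>K.
    (c + comparison (k, l, q) x < 0 \<longrightarrow> c + comparison (k, l, q) y < 0) \<and>
    (\<not> (k = q \<and> l = q) \<longrightarrow> c + comparison (k, l, q) y \<noteq> 0)"
proof -
  let ?X = "powertop_real K"
  define T where "T = C \<times> K \<times> K \<times> K"
  have T: "finite T" using assms(3) by (simp add: T_def)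
  define N where "N = {p \<in> T. fst p + comparison (snd p) x < 0}"
  define U where "U = (\<Inter>p\<in>N. {y \<in> topspace ?X. fst p + comparison (snd p) y \<in> {..<0}}) \<inter> topspace ?X"
  have "openin ?X U"
    unfolding U_def
  proof (rule openin_INT)
    show "finite N" using T by (simp add: N_def)
    fix p assume "p \<in> N"
    then obtain c k l q where p: "p = (c, k, l, q)" "k \<in> K" "l \<in> K" "q \<in> K"
      by (cases p) (auto simp: N_def T_def)
    then show "openin ?X {y \<in> topspace ?X. fst p + comparison (snd p) y \<in> {..<0}}"
      using openin_continuous_map_preimage[OF continuous_map_comparison[of k K l q c], of "{..<0}"] by simp
  qed
  moreover have x: "x \<in> ?X closure_of (?X interior_of S)"
    using assms(1,2) by (auto simp: regular_in_def)
  moreover have "x \<in> U" using x by (auto simp: U_def N_def in_closure_of)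
  ultimately obtain w where w: "w \<in> ?X interior_of S" "w \<in> U" by (auto simp: in_closure_of)
  define V where "V = {(c, k, l, q). (c, k, l, q) \<in> T \<and> \<not> (k = q \<and> l = q)}"
  have "\<exists>y\<in>U \<inter> ?X interior_of S. \<forall>(c, t)\<in>V. c + comparison t y \<noteq> 0"
  proof (rule open_avoids_finitely_many_comparison_zeros)
    show "openin ?X (U \<inter> ?X interior_of S)" using \<open>openin ?X U\<close> by (intro openin_Int) auto
    show "U \<inter> ?X interior_of S \<noteq> {}" using w by blast
    show "finite V" using T by (rule rev_finite_subset) (auto simp: V_def)
  qed (auto simp: T_def V_def)
  then obtain y where y_in: "y \<in> U \<inter> ?X interior_of S"
    and y_nz: "\<forall>(c, t)\<in>V. c + comparison t y \<noteq> 0"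
    by (rule bexE)
  show ?thesis
  proof (intro bexI ballI conjI impI)
    show "y \<in> S" by (rule subsetD[OF interior_of_subset IntD2[OF y_in]])
  next
    fix c k l q
    assume "c \<in> C" "k \<in> K" "l \<in> K" "q \<in> K" "c + comparison (k, l, q) x < 0"
    then have "(c, k, l, q) \<in> N" by (simp add: N_def T_def)
    then show "c + comparison (k, l, q) y < 0" using y_in by (auto simp: U_def)
  next
    fix c k l q
    assume "c \<in> C" "k \<in> K" "l \<in> K" "q \<in> K" "\<not> (k = q \<and> l = q)"
    then show "c + comparison (k, l, q) y \<noteq> 0"
      using bspec[OF y_nz, of "(c, k, l, q)"] by (simp add: T_def V_def)
  qed
qed

section \<open>Lifting generic points\<close>

lemma pcoeff_pmonom_fun: "pcoeff (pmonom r l) = (\<lambda>a. if a = l then r else 0)"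
  by (simp add: fun_eq_iff pcoeff_pmonom)

lemma pmonom_mult: "pmonom r l * pmonom s m = pmonom (r * s) (l + m)"
  by (rule puiseux_eqI) (auto simp: pcoeff_mult pcoeff_pmonom_fun conv_single_left)

lemma lead_pmonom:
  assumes "r \<noteq> 0"
  shows "lead_exp (pmonom r l) = l" "lc (pmonom r l) = r" "pmonom r l \<noteq> 0"
  using lead_expI[of "pmonom r l" l] assms by (auto simp: pcoeff_pmonom split: if_splits)

lemma pmonom_pos: "0 < r \<Longrightarrow> 0 < pmonom r l"
  by (simp add: lead_pmonom flip: lc_pos_iff)

text \<open>
  The valuation decides if the exponents \<open>lead_exp a + \<xi>\<close> and \<open>lead_exp b + \<eta>\<close> differ.
  If they agree, then \<open>\<alpha> > \<beta>\<close>, and the leading coefficients are constant multiples of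
  \<open>s powr \<alpha>\<close> and \<open>s powr \<beta>\<close>.
\<close>

lemma eventually_monomial_dominates:
  assumes ab: "0 < a" "0 < b" and M: "0 < M"
    and ge: "lead_exp b + \<eta> \<le> lead_exp a + \<xi>"
    and gr: "lead_exp b + \<eta> + \<beta> < lead_exp a + \<xi> + \<alpha>"
  shows "\<forall>\<^sub>F s in at_top. of_nat M * (b * pmonom (s powr \<beta>) \<eta>) < a * pmonom (s powr \<alpha>) \<xi>"
proof -
  have nz: "a \<noteq> 0" "b \<noteq> 0" "of_nat M \<noteq> (0 :: puiseux)" using ab M by auto
  have lead: "lead_exp (w * pmonom r \<zeta>) = lead_exp w + \<zeta>" "lc (w * pmonom r \<zeta>) = lc w * r" "0 < w * pmonom r \<zeta>"
    if "0 < w" "0 < r" for w r \<zeta>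
  proof -
    have "w \<noteq> 0" "r \<noteq> 0" using that by auto
    then show "lead_exp (w * pmonom r \<zeta>) = lead_exp w + \<zeta>" "lc (w * pmonom r \<zeta>) = lc w * r"
      by (simp_all add: lead_mult lead_pmonom)
    show "0 < w * pmonom r \<zeta>" using that by (intro mult_pos_pos pmonom_pos)
  qed
  have Mb: "0 < of_nat M * b" using ab M by simp
  have M': "lead_exp (of_nat M * b) = lead_exp b" "lc (of_nat M * b) = real M * lc b"
    using lead_mult(1,2)[OF nz(3,2)] lead_of_nat[of M] M by simp_all
  note a = lead[OF ab(1)] and b = lead[OF Mb, unfolded M' mult.assoc]
  show ?thesis
  proof (cases "lead_exp b + \<eta> < lead_exp a + \<xi>")
    case True
    show ?thesis
      using eventually_gt_at_top[of 0]
    proof eventually_elim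
      case (elim s)
      then have s: "0 < s powr \<alpha>" "0 < s powr \<beta>" by simp_all
      show ?case
        by (rule less_if_lead_exp_less[OF a(3)[OF s(1)]]) (simp only: a(1)[OF s(1)] b(1)[OF s(2)] True)
    qed
  next
    case False
    then have eq: "lead_exp b + \<eta> = lead_exp a + \<xi>" using ge by simp
    define \<delta> where "\<delta> = \<alpha> - \<beta>"
    have \<delta>: "0 < \<delta>" using gr eq by (simp add: \<delta>_def)
    have lc: "0 < lc a" "0 < lc b" using ab by (simp_all add: lc_pos_iff)
    \<comment> \<open>the leading coefficients are in the right order as soon as \<open>s powr \<delta>\<close> exceeds \<open>R\<close>\<close>
    define R where "R = real M * lc b / lc a"
    have R: "0 < R" using lc M by (simp add: R_def)
    show ?thesis
      using eventually_gt_at_top[of "R powr (1 / \<delta>)"]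
    proof eventually_elim
      case (elim s)
      have s: "0 < s" using elim R by (meson le_less_trans powr_ge_zero)
      have "R = (R powr (1 / \<delta>)) powr \<delta>" using R \<delta> by (simp add: powr_powr)
      also have "\<dots> < s powr \<delta>" using elim \<delta> by (intro powr_less_mono2) auto
      finally have "R * s powr \<beta> < s powr \<delta> * s powr \<beta>" using s by simp
      also have "\<dots> = s powr \<alpha>" by (simp add: \<delta>_def flip: powr_add)
      finally have lc_less: "real M * (lc b * s powr \<beta>) < lc a * s powr \<alpha>"
        using lc by (simp add: R_def field_simps)
      have s': "0 < s powr \<alpha>" "0 < s powr \<beta>" using s by simp_all
      show ?case
      proof (rule less_if_lc_less)
        show "a * pmonom (s powr \<alpha>) \<xi> \<noteq> 0" using a(3)[OF s'(1)] by (rule less_imp_neq[symmetric])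
        show "of_nat M * (b * pmonom (s powr \<beta>) \<eta>) \<noteq> 0" using b(3)[OF s'(2)] by (rule less_imp_neq[symmetric])
      qed (simp_all only: a(1,2)[OF s'(1)] b(1,2)[OF s'(2)] eq lc_less)
    qed
  qed
qed

text \<open>
  The point \<open>z\<close> has valuation \<open>x\<close>, while its leading coefficients \<open>s powr (y k - x k)\<close> record the
  direction from \<open>x\<close> to \<open>y\<close>. So comparisons that are strict at \<open>y\<close> and weak at \<open>x\<close> become
  inequalities with an arbitrary constant \<open>M\<close>. Only finitely many are required, hence some \<open>s\<close>
  serves for all of them.
\<close>

lemma ex_dominating_lift:
  fixes x y :: "'n \<Rightarrow> real"
  assumes fin: "finite E" "finite K" and pos: "\<And>f. f \<in> E \<Longrightarrow> 0 < f" and M: "0 < M"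
  shows "\<exists>z. (\<forall>k. 0 < z k \<and> val (z k) = ereal (x k)) \<and>
    (\<forall>f\<in>E. \<forall>g\<in>E. \<forall>h\<in>E. \<forall>k\<in>K. \<forall>l\<in>K. \<forall>q\<in>K.
      0 \<le> lead_exp f + lead_exp g - 2 * lead_exp h + comparison (k, l, q) x \<longrightarrow>
      0 < lead_exp f + lead_exp g - 2 * lead_exp h + comparison (k, l, q) y \<longrightarrow>
      of_nat M * (h * z q)\<^sup>2 \<le> (f * z k) * (g * z l))"
proof -
  define z where "z s k = pmonom (s powr (y k - x k)) (x k)" for s :: real and k
  have "\<forall>\<^sub>F s in at_top. \<forall>f\<in>E. \<forall>g\<in>E. \<forall>h\<in>E. \<forall>k\<in>K. \<forall>l\<in>K. \<forall>q\<in>K.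
      0 \<le> lead_exp f + lead_exp g - 2 * lead_exp h + comparison (k, l, q) x \<longrightarrow>
      0 < lead_exp f + lead_exp g - 2 * lead_exp h + comparison (k, l, q) y \<longrightarrow>
      of_nat M * (h * z s q)\<^sup>2 \<le> (f * z s k) * (g * z s l)"
  proof (intro eventually_ball_finite fin ballI)
    fix f g h k l q
    assume E: "f \<in> E" "g \<in> E" "h \<in> E"
    have nz: "f \<noteq> 0" "g \<noteq> 0" "h \<noteq> 0" using pos[OF E(1)] pos[OF E(2)] pos[OF E(3)] by auto
    have sq: "(h * z s q)\<^sup>2 = (h * h) * pmonom (s powr (2 * (y q - x q))) (2 * x q)" for s
      by (simp add: z_def power2_eq_square mult_ac pmonom_mult flip: powr_add)
    have pr: "(f * z s k) * (g * z s l) =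
        (f * g) * pmonom (s powr ((y k - x k) + (y l - x l))) (x k + x l)" for s
    proof -
      have "(f * z s k) * (g * z s l) = (f * g) * (z s k * z s l)" by (simp add: mult_ac)
      then show ?thesis by (simp add: z_def pmonom_mult powr_add)
    qed
    show "\<forall>\<^sub>F s in at_top. 0 \<le> lead_exp f + lead_exp g - 2 * lead_exp h + comparison (k, l, q) x \<longrightarrow>
      0 < lead_exp f + lead_exp g - 2 * lead_exp h + comparison (k, l, q) y \<longrightarrow>
      of_nat M * (h * z s q)\<^sup>2 \<le> (f * z s k) * (g * z s l)"
    proof (cases "0 \<le> lead_exp f + lead_exp g - 2 * lead_exp h + comparison (k, l, q) x \<and>
      0 < lead_exp f + lead_exp g - 2 * lead_exp h + comparison (k, l, q) y")
      case True
      have le: "lead_exp (f * g) = lead_exp f + lead_exp g" "lead_exp (h * h) = 2 * lead_exp h"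
        using nz by (simp_all add: lead_mult)
      have "\<forall>\<^sub>F s in at_top. of_nat M * (h * z s q)\<^sup>2 < (f * z s k) * (g * z s l)"
        unfolding sq pr
      proof (rule eventually_monomial_dominates)
        show "0 < f * g" "0 < h * h" using pos E by simp_all
        show "lead_exp (h * h) + 2 * x q \<le> lead_exp (f * g) + (x k + x l)"
          using True unfolding le comparison_def by simp
        show "lead_exp (h * h) + 2 * x q + 2 * (y q - x q) <
            lead_exp (f * g) + (x k + x l) + ((y k - x k) + (y l - x l))"
          using True unfolding le comparison_def by simp
      qed (rule M)
      then show ?thesis by eventually_elim simp
    qed (auto intro!: always_eventually)
  qed
  then have "\<forall>\<^sub>F s in at_top. 0 < s \<and> (\<forall>f\<in>E. \<forall>g\<in>E. \<forall>h\<in>E. \<forall>k\<in>K. \<forall>l\<in>K. \<forall>q\<in>K.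
      0 \<le> lead_exp f + lead_exp g - 2 * lead_exp h + comparison (k, l, q) x \<longrightarrow>
      0 < lead_exp f + lead_exp g - 2 * lead_exp h + comparison (k, l, q) y \<longrightarrow>
      of_nat M * (h * z s q)\<^sup>2 \<le> (f * z s k) * (g * z s l))"
    by (intro eventually_conj eventually_gt_at_top)
  from eventually_happens[OF this] obtain s where s: "0 < s"
    "\<forall>f\<in>E. \<forall>g\<in>E. \<forall>h\<in>E. \<forall>k\<in>K. \<forall>l\<in>K. \<forall>q\<in>K.
      0 \<le> lead_exp f + lead_exp g - 2 * lead_exp h + comparison (k, l, q) x \<longrightarrow>
      0 < lead_exp f + lead_exp g - 2 * lead_exp h + comparison (k, l, q) y \<longrightarrow>
      of_nat M * (h * z s q)\<^sup>2 \<le> (f * z s k) * (g * z s l)" by auto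
  have "0 < z s k \<and> val (z s k) = ereal (x k)" for k
    using s(1) by (simp add: z_def pmonom_pos lead_pmonom val_nonzero)
  then show ?thesis using s(2) by blast
qed

text \<open>
  The negative summands together amount to at most half of \<open>u k\<close>.
\<close>

lemma dominant_term_le_sum:
  fixes u :: "'n \<Rightarrow> 'a::linordered_field"
  assumes K: "finite K" "k \<in> K" and pos: "0 < u k"
    and dom: "\<And>l. l \<in> K \<Longrightarrow> u l < 0 \<Longrightarrow> of_nat N * \<bar>u l\<bar> \<le> u k"
    and N: "2 * card K \<le> N"
  shows "u k \<le> 2 * (\<Sum>l\<in>K. u l)"
proof -
  have N0: "0 < N"
  proof -
    have "0 < card K" using K by (auto simp: card_gt_0_iff)
    then show ?thesis using N by linarith
  qed
  then have N_pos: "(0 :: 'a) < of_nat N" by simp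
  have "- (u k / of_nat N) \<le> u l" if "l \<in> K" for l
  proof (cases "u l < 0")
    case True
    then have "(- u l) * of_nat N \<le> u k" using dom[OF that True] by (simp add: mult.commute)
    then have "- u l \<le> u k / of_nat N" using N_pos by (simp only: pos_le_divide_eq)
    then show ?thesis by simp
  next
    case False
    moreover have "0 \<le> u k / of_nat N" using pos N_pos by simp
    ultimately show ?thesis by linarith
  qed
  then have "(\<Sum>l\<in>K - {k}. - (u k / of_nat N)) \<le> (\<Sum>l\<in>K - {k}. u l)" by (intro sum_mono) simp
  moreover have "of_nat (card (K - {k})) * (u k / of_nat N) \<le> u k / 2"
  proof -
    have "2 * card (K - {k}) \<le> N" using N K by (simp add: card_Diff_singleton)
    then have "of_nat (2 * card (K - {k})) \<le> (of_nat N :: 'a)" by (simp only: of_nat_le_iff)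
    then have "2 * of_nat (card (K - {k})) * u k \<le> of_nat N * u k"
      using pos by (intro mult_right_mono) simp_all
    then show ?thesis using N_pos by (simp add: field_simps)
  qed
  moreover have "(\<Sum>l\<in>K. u l) = u k + (\<Sum>l\<in>K - {k}. u l)" using K by (rule sum.remove)
  ultimately have "u k - u k / 2 \<le> (\<Sum>l\<in>K. u l)" by simp
  then show ?thesis by simp
qed

lemma square_sum_le_if_squares_le:
  fixes u :: "'n \<Rightarrow> 'a::linordered_field"
  assumes "finite K" and le: "\<And>l. l \<in> K \<Longrightarrow> (of_nat (card K * c) * u l)\<^sup>2 \<le> t" and t: "0 \<le> t"
  shows "(of_nat c * (\<Sum>l\<in>K. u l))\<^sup>2 \<le> t"
proof (cases "K = {}")
  case False
  obtain p where p: "p \<in> K" "\<And>l. l \<in> K \<Longrightarrow> \<bar>u l\<bar> \<le> \<bar>u p\<bar>"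
  proof -
    have "Max ((\<lambda>l. \<bar>u l\<bar>) ` K) \<in> (\<lambda>l. \<bar>u l\<bar>) ` K" using assms(1) False by (intro Max_in) auto
    then obtain p where "Max ((\<lambda>l. \<bar>u l\<bar>) ` K) = \<bar>u p\<bar>" "p \<in> K" by (rule imageE)
    then show ?thesis using that[of p] Max_ge[of "(\<lambda>l. \<bar>u l\<bar>) ` K"] assms(1) by simp
  qed
  have "\<bar>\<Sum>l\<in>K. u l\<bar> \<le> (\<Sum>l\<in>K. \<bar>u l\<bar>)" by (rule sum_abs)
  also have "\<dots> \<le> of_nat (card K) * \<bar>u p\<bar>" using p(2) by (rule sum_bounded_above)
  finally have "of_nat c * \<bar>\<Sum>l\<in>K. u l\<bar> \<le> of_nat c * (of_nat (card K) * \<bar>u p\<bar>)"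
    by (rule mult_left_mono) simp
  then have "\<bar>of_nat c * (\<Sum>l\<in>K. u l)\<bar> \<le> \<bar>of_nat (card K * c) * u p\<bar>" by (simp add: abs_mult mult_ac)
  then have "(of_nat c * (\<Sum>l\<in>K. u l))\<^sup>2 \<le> (of_nat (card K * c) * u p)\<^sup>2" by (simp only: abs_le_square_iff)
  also have "\<dots> \<le> t" using p(1) by (rule le)
  finally show ?thesis .
qed (use t in simp)

section \<open>Lifts with prescribed signs of the off-diagonal entries\<close>

lemma lead_exp_uminus: "lead_exp (- a) = lead_exp a"
  by (simp add: lead_exp_def)

text \<open>
  Either the linear form vanishes on the coordinates in \<open>K\<close>, or the term that attains
  \<open>q\<^sup>+\<close> at \<open>X\<close> dominates all negative terms. In the second case the value of the form at the lift is
  comparable to this term, not only nonnegative; that is needed to bound products of diagonal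
  entries from below.
\<close>

lemma dominant_term_if_trop_plus_le:
  fixes q :: "'n::finite \<Rightarrow> puiseux"
  assumes X: "X \<in> trop_space" "K = {k. X $ k \<noteq> -\<infinity>}" "\<And>k. k \<in> K \<Longrightarrow> X $ k = ereal (y k)"
    and le: "trop_plus (\<lambda>k. - q k) X \<le> trop_plus q X"
    and z: "\<And>k. k \<in> K \<Longrightarrow> 0 < z k"
    and dom: "\<And>k l. k \<in> K \<Longrightarrow> l \<in> K \<Longrightarrow> 0 < q k \<Longrightarrow> q l < 0 \<Longrightarrow>
      lead_exp (q l) + y l \<le> lead_exp (q k) + y k \<Longrightarrow> of_nat N * \<bar>q l * z l\<bar> \<le> q k * z k"
    and N: "2 * card K \<le> N"
  shows "trop_plus q X = -\<infinity> \<and> (\<forall>k\<in>K. q k = 0) \<or>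
    (\<exists>k\<in>K. 0 < q k \<and> trop_plus q X = ereal (lead_exp (q k) + y k) \<and>
      q k * z k \<le> 2 * (\<Sum>l\<in>K. q l * z l))"
proof (cases "trop_plus q X = -\<infinity>")
  case True
  then have "trop_plus (\<lambda>k. - q k) X = -\<infinity>" using le by simp
  with True have bot: "val (q k) + X $ k \<le> -\<infinity>" for k
    using term_le_trop_plus[OF X(1), of q k] by simp
  have "q k = 0" if "k \<in> K" for k
  proof (rule ccontr)
    assume "q k \<noteq> 0"
    then show False using bot[of k] X(3)[OF that] by (simp add: val_nonzero)
  qed
  then show ?thesis using True by blast
next
  case False
  then obtain k where k: "0 < q k" "trop_plus q X = val (q k) + X $ k" by (rule trop_plus_attained)
  have "X $ k \<noteq> -\<infinity>" using False k(2) by auto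
  then have kK: "k \<in> K" by (simp add: X(2))
  have eq: "trop_plus q X = ereal (lead_exp (q k) + y k)"
    using k X(3)[OF kK] by (simp add: val_nonzero)
  have "q k * z k \<le> 2 * (\<Sum>l\<in>K. q l * z l)"
  proof (rule dominant_term_le_sum[OF _ kK _ _ N])
    show "0 < q k * z k" using k(1) z[OF kK] by simp
    fix l assume l: "l \<in> K" "q l * z l < 0"
    then have neg: "q l < 0" using z[OF l(1)] by (simp add: mult_less_0_iff)
    have "val (- q l) + X $ l \<le> trop_plus (\<lambda>k. - q k) X"
      using neg by (intro trop_plus_upper) simp
    then have "val (q l) + X $ l \<le> trop_plus q X" using le by simp
    then have "lead_exp (q l) + y l \<le> lead_exp (q k) + y k"
      using neg X(3)[OF l(1)] unfolding eq by (simp add: val_nonzero)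
    then show "of_nat N * \<bar>q l * z l\<bar> \<le> q k * z k" by (rule dom[OF kK l(1) k(1) neg])
  qed simp
  then show ?thesis using kK k(1) eq by blast
qed

lemma pencil_on_support:
  assumes "\<And>k. k \<notin> K \<Longrightarrow> z $ k = 0"
  shows "pencil Q z $ i $ j = (\<Sum>k\<in>K. Q k $ i $ j * z $ k)"
proof -
  have "pencil Q z $ i $ j = (\<Sum>k\<in>UNIV. Q k $ i $ j * z $ k)"
    by (simp add: pencil_def mult.commute)
  also have "\<dots> = (\<Sum>k\<in>K. Q k $ i $ j * z $ k)"
    using assms by (intro sum.mono_neutral_right) auto
  finally show ?thesis .
qed

lemma pencil_linear:
  "pencil Q (a *s y + b *s z) $ i $ j = a * pencil Q y $ i $ j + b * pencil Q z $ i $ j"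
  by (simp add: pencil_def distrib_right sum.distrib sum_distrib_left mult.assoc)

definition sign_relation :: "('p \<Rightarrow> bool) \<Rightarrow> 'p \<Rightarrow> ereal \<Rightarrow> ereal \<Rightarrow> bool" where
  "sign_relation \<sigma> p = (if \<sigma> p then (\<ge>) else (\<le>))"

text \<open>
  The region for the comparisons \<open>\<ge>\<close> where \<open>\<sigma>\<close> holds and \<open>\<le>\<close> elsewhere. The restriction makes
  the family of comparisons extensional.
\<close>

definition sign_region ::
    "('n::finite \<Rightarrow> puiseux ^ 'm::{finite,linorder} ^ 'm::{finite,linorder}) \<Rightarrow>
     ('m \<times> 'm) set \<Rightarrow> ('m \<times> 'm \<Rightarrow> bool) \<Rightarrow> (ereal ^ 'n) set" where
  "sign_region Q \<Sigma> \<sigma> =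
     trop_region \<Sigma> (restrict (sign_relation \<sigma>) (pairs_compl \<Sigma>)) (sval_mats Q)"

text \<open>
  The weak inequalities that hold at the nearby generic point \<open>X\<close> are strict there, because equality
  of two terms would put the point on one of the avoided hyperplanes. The one
  exception is the comparison of \<open>Q\<^sub>i\<^sub>i\<^sup>(\<^sup>p\<^sup>) Q\<^sub>j\<^sub>j\<^sup>(\<^sup>p\<^sup>) X\<^sub>p\<^sup>2\<close> with \<open>(Q\<^sub>i\<^sub>j\<^sup>(\<^sup>p\<^sup>) X\<^sub>p)\<^sup>2\<close>, where the
  coordinates cancel and equality is excluded by \<open>generic\<close>. Strict inequalities carry over to the
  lift with any constant.
\<close>

lemma ex_lift_with_signs:
  fixes Q :: "'n::finite \<Rightarrow> puiseux ^ 'm::{finite,linorder} ^ 'm::{finite,linorder}"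
  assumes generic: "\<And>k i j. i \<noteq> j \<Longrightarrow> 0 < Q k $ i $ i \<Longrightarrow> 0 < Q k $ j $ j \<Longrightarrow>
      val (Q k $ i $ i) + val (Q k $ j $ j) \<noteq> 2 * val (Q k $ i $ j)"
    and \<Sigma>: "\<Sigma> \<subseteq> {(i, j). i < j}"
    and K: "K = {k. x $ k \<noteq> -\<infinity>}" "K \<noteq> {}"
    and x: "x \<in> sign_region Q \<Sigma> \<sigma>"
    and reg: "regular_in K (stratum K (sign_region Q \<Sigma> \<sigma>))"
  shows "\<exists>z. (\<forall>k. 0 \<le> z $ k) \<and> val_vec z = x \<and> (\<forall>i. 0 \<le> pencil Q z $ i $ i) \<and>
    (\<forall>(i, j)\<in>\<Sigma>. (of_nat CARD('m) * pencil Q z $ i $ j)\<^sup>2 \<le> pencil Q z $ i $ i * pencil Q z $ j $ j) \<and>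
    (\<forall>p\<in>pairs_compl \<Sigma>. if \<sigma> p then 0 \<le> pencil Q z $ fst p $ snd p else pencil Q z $ fst p $ snd p \<le> 0)"
proof -
  define E where "E = {f. 0 < f \<and> (\<exists>k i j. f = Q k $ i $ j \<or> f = - Q k $ i $ j)}"
  have finE: "finite E"
  proof (rule finite_subset)
    show "E \<subseteq> (\<Union>k. \<Union>i. \<Union>j. {Q k $ i $ j, - Q k $ i $ j})"
      unfolding E_def by blast
  qed simp
  define c where "c f g h = lead_exp f + lead_exp g - 2 * lead_exp h" for f g h
  define xr where "xr = (\<lambda>k\<in>K. real_of_ereal (x $ k))"
  have x_space: "x \<in> trop_space" using x by (simp add: sign_region_def trop_region_def)
  have xr: "x $ k = ereal (xr k)" if "k \<in> K" for k
    using that x_space K(1) by (cases "x $ k") (auto simp: xr_def trop_space_def)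
  have "xr \<in> stratum K (sign_region Q \<Sigma> \<sigma>)"
    unfolding stratum_def xr_def using x K(1) by blast
  moreover have "finite ((\<lambda>(f, g, h). c f g h) ` (E \<times> E \<times> E))" using finE by simp
  ultimately have "\<exists>y\<in>stratum K (sign_region Q \<Sigma> \<sigma>). \<forall>r\<in>(\<lambda>(f, g, h). c f g h) ` (E \<times> E \<times> E).
      \<forall>k\<in>K. \<forall>l\<in>K. \<forall>q\<in>K. (r + comparison (k, l, q) xr < 0 \<longrightarrow> r + comparison (k, l, q) y < 0) \<and>
      (\<not> (k = q \<and> l = q) \<longrightarrow> r + comparison (k, l, q) y \<noteq> 0)"
    by (rule regular_generic_approximation[OF reg])
  then obtain y where y_in: "y \<in> stratum K (sign_region Q \<Sigma> \<sigma>)"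
    and approx: "\<forall>r\<in>(\<lambda>(f, g, h). c f g h) ` (E \<times> E \<times> E).
      \<forall>k\<in>K. \<forall>l\<in>K. \<forall>q\<in>K. (r + comparison (k, l, q) xr < 0 \<longrightarrow> r + comparison (k, l, q) y < 0) \<and>
      (\<not> (k = q \<and> l = q) \<longrightarrow> r + comparison (k, l, q) y \<noteq> 0)"
    by (rule bexE)
  have approx': "(c f g h + comparison (k, l, q) xr < 0 \<longrightarrow> c f g h + comparison (k, l, q) y < 0) \<and>
      (\<not> (k = q \<and> l = q) \<longrightarrow> c f g h + comparison (k, l, q) y \<noteq> 0)"
    if E: "f \<in> E" "g \<in> E" "h \<in> E" and K: "k \<in> K" "l \<in> K" "q \<in> K" for f g h k l q
  proof -
    have "c f g h \<in> (\<lambda>(f, g, h). c f g h) ` (E \<times> E \<times> E)"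
      using E by (intro image_eqI[of _ _ "(f, g, h)"]) simp_all
    then show ?thesis by (rule bspec[OF bspec[OF bspec[OF bspec[OF approx] K(1)] K(2)] K(3)])
  qed
  obtain X where X: "X \<in> sign_region Q \<Sigma> \<sigma>" "K = {k. X $ k \<noteq> -\<infinity>}" "y = (\<lambda>k\<in>K. real_of_ereal (X $ k))"
    using y_in unfolding stratum_def by blast
  have X_space: "X \<in> trop_space" using X(1) by (simp add: sign_region_def trop_region_def)
  have Xy: "X $ k = ereal (y k)" if "k \<in> K" for k
  proof -
    have "X $ k \<noteq> -\<infinity>" "X $ k \<noteq> \<infinity>" using that X(2) X_space by (auto simp: trop_space_def)
    then show ?thesis using that by (cases "X $ k") (auto simp: X(3))
  qed
  have diag: "trop_plus (\<lambda>k. - Q k $ i $ i) X \<le> trop_plus (\<lambda>k. Q k $ i $ i) X" for i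
    using X(1) by (simp add: sign_region_def trop_region_def Qplus_eq Qminus_eq)
  have square: "2 * max (trop_plus (\<lambda>k. Q k $ i $ j) X) (trop_plus (\<lambda>k. - Q k $ i $ j) X)
      \<le> trop_plus (\<lambda>k. Q k $ i $ i) X + trop_plus (\<lambda>k. Q k $ j $ j) X" if "(i, j) \<in> \<Sigma>" for i j
    using X(1) that by (auto simp: sign_region_def trop_region_def Qplus_eq Qminus_eq)
  have sign: "sign_relation \<sigma> (i, j) (trop_plus (\<lambda>k. Q k $ i $ j) X) (trop_plus (\<lambda>k. - Q k $ i $ j) X)"
    if "(i, j) \<in> pairs_compl \<Sigma>" for i j
    using X(1) that by (auto simp: sign_region_def trop_region_def Qplus_eq Qminus_eq)
  \<comment> \<open>The factor 2 absorbs the losses in the two diagonal entries, \<open>card K\<close> the number of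
    summands of the off-diagonal entry, and \<open>CARD('m)\<close> is the factor in the claim.\<close>
  define N where "N = 2 * (card K * CARD('m))"
  have cK: "0 < card K" using K(2) by (simp add: card_gt_0_iff)
  then have N: "0 < N" "2 * card K \<le> N" by (simp_all add: N_def)
  have "\<exists>\<zeta>. (\<forall>k. 0 < \<zeta> k \<and> val (\<zeta> k) = ereal (xr k)) \<and> (\<forall>f\<in>E. \<forall>g\<in>E. \<forall>h\<in>E. \<forall>k\<in>K. \<forall>l\<in>K. \<forall>q\<in>K.
      0 \<le> c f g h + comparison (k, l, q) xr \<longrightarrow>
      0 < c f g h + comparison (k, l, q) y \<longrightarrow>
      of_nat (N\<^sup>2) * (h * \<zeta> q)\<^sup>2 \<le> (f * \<zeta> k) * (g * \<zeta> l))"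
    unfolding c_def
  proof (rule ex_dominating_lift)
    show "0 < f" if "f \<in> E" for f using that by (simp add: E_def)
    show "0 < N\<^sup>2" using N(1) by simp
  qed (use finE in simp_all)
  then obtain \<zeta> where \<zeta>0: "\<forall>k. 0 < \<zeta> k \<and> val (\<zeta> k) = ereal (xr k)"
    and dom0: "\<forall>f\<in>E. \<forall>g\<in>E. \<forall>h\<in>E. \<forall>k\<in>K. \<forall>l\<in>K. \<forall>q\<in>K.
      0 \<le> c f g h + comparison (k, l, q) xr \<longrightarrow>
      0 < c f g h + comparison (k, l, q) y \<longrightarrow>
      of_nat (N\<^sup>2) * (h * \<zeta> q)\<^sup>2 \<le> (f * \<zeta> k) * (g * \<zeta> l)"
    by (elim exE conjE) (rule that)
  have \<zeta>: "0 < \<zeta> k" "val (\<zeta> k) = ereal (xr k)" for k using \<zeta>0 by simp_all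
  have dom: "(of_nat N * (h * \<zeta> q))\<^sup>2 \<le> (f * \<zeta> k) * (g * \<zeta> l)"
    if "f \<in> E" "g \<in> E" "h \<in> E" "k \<in> K" "l \<in> K" "q \<in> K"
      and ge: "0 \<le> c f g h + comparison (k, l, q) y" and ne: "c f g h + comparison (k, l, q) y \<noteq> 0"
    for f g h k l q
  proof -
    have "0 \<le> c f g h + comparison (k, l, q) xr"
      using approx'[OF that(1-6)] ge by linarith
    moreover have "0 < c f g h + comparison (k, l, q) y" using ge ne by simp
    ultimately have "of_nat (N\<^sup>2) * (h * \<zeta> q)\<^sup>2 \<le> (f * \<zeta> k) * (g * \<zeta> l)"
      using dom0 that(1-6) by blast
    then show ?thesis by (simp add: power_mult_distrib)
  qed
  have gen_c: "c f g h + comparison (k, l, q) y \<noteq> 0"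
    if "f \<in> E" "g \<in> E" "h \<in> E" "k \<in> K" "l \<in> K" "q \<in> K" "\<not> (k = q \<and> l = q)" for f g h k l q
    using approx'[OF that(1-6)] that(7) by (simp only: simp_thms)
  have form: "trop_plus q X = -\<infinity> \<and> (\<forall>k\<in>K. q k = 0) \<or>
      (\<exists>k\<in>K. 0 < q k \<and> trop_plus q X = ereal (lead_exp (q k) + y k) \<and>
        q k * \<zeta> k \<le> 2 * (\<Sum>l\<in>K. q l * \<zeta> l))"
    if le: "trop_plus (\<lambda>k. - q k) X \<le> trop_plus q X"
      and q: "\<And>k. 0 < q k \<Longrightarrow> q k \<in> E" "\<And>k. q k < 0 \<Longrightarrow> - q k \<in> E" for q
  proof (rule dominant_term_if_trop_plus_le[OF X_space X(2) Xy le \<zeta>(1) _ N(2)])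
    fix k l
    assume kl: "k \<in> K" "l \<in> K" and pos: "0 < q k" and neg: "q l < 0"
      and ge: "lead_exp (q l) + y l \<le> lead_exp (q k) + y k"
    have E: "q k \<in> E" "- q l \<in> E" using q pos neg by auto
    \<comment> \<open>terms of opposite signs belong to different variables, so their comparison is generic\<close>
    have "k \<noteq> l" using pos neg by auto
    then have "c (q k) (q k) (- q l) + comparison (k, k, l) y \<noteq> 0"
      using kl E by (intro gen_c) auto
    moreover have "0 \<le> c (q k) (q k) (- q l) + comparison (k, k, l) y"
      using ge by (simp add: c_def comparison_def lead_exp_uminus)
    ultimately have "(of_nat N * (- q l * \<zeta> l))\<^sup>2 \<le> (q k * \<zeta> k) * (q k * \<zeta> k)"
      using kl E by (intro dom)
    moreover have "(of_nat N * \<bar>q l * \<zeta> l\<bar>)\<^sup>2 = (of_nat N * (- q l * \<zeta> l))\<^sup>2"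
      by (simp add: power_mult_distrib)
    ultimately have "(of_nat N * \<bar>q l * \<zeta> l\<bar>)\<^sup>2 \<le> (q k * \<zeta> k)\<^sup>2"
      by (simp only: power2_eq_square[of "q k * \<zeta> k"])
    then show "of_nat N * \<bar>q l * \<zeta> l\<bar> \<le> q k * \<zeta> k"
      by (rule power2_le_imp_le) (use pos \<zeta>(1)[of k] in simp)
  qed
  have nonneg: "0 \<le> (\<Sum>l\<in>K. q l * \<zeta> l)"
    if "trop_plus (\<lambda>k. - q k) X \<le> trop_plus q X"
      and "\<And>k. 0 < q k \<Longrightarrow> q k \<in> E" "\<And>k. q k < 0 \<Longrightarrow> - q k \<in> E" for q
  proof -
    have "trop_plus q X = -\<infinity> \<and> (\<forall>k\<in>K. q k = 0) \<or>
      (\<exists>k\<in>K. 0 < q k \<and> trop_plus q X = ereal (lead_exp (q k) + y k) \<and>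
        q k * \<zeta> k \<le> 2 * (\<Sum>l\<in>K. q l * \<zeta> l))"
      by (rule form[of q]) (fact that)+
    then show ?thesis
    proof (elim disjE conjE bexE)
      fix k assume "0 < q k" and le: "q k * \<zeta> k \<le> 2 * (\<Sum>l\<in>K. q l * \<zeta> l)"
      then have "0 < q k * \<zeta> k" using \<zeta>(1)[of k] by simp
      then have "0 < 2 * (\<Sum>l\<in>K. q l * \<zeta> l)" using le by (rule less_le_trans)
      then show ?thesis by simp
    qed simp
  qed
  have E_entry: "0 < Q k $ i $ j \<Longrightarrow> Q k $ i $ j \<in> E" "Q k $ i $ j < 0 \<Longrightarrow> - Q k $ i $ j \<in> E" for k i j
    by (auto simp: E_def)
  define z where "z = (\<chi> k. if k \<in> K then \<zeta> k else 0)"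
  have pencil_z: "pencil Q z $ i $ j = (\<Sum>k\<in>K. Q k $ i $ j * \<zeta> k)" for i j
    by (subst pencil_on_support[of K]) (auto simp: z_def intro!: sum.cong)
  have diag_nonneg: "0 \<le> pencil Q z $ i $ i" for i
    unfolding pencil_z by (rule nonneg) (simp_all add: diag E_entry)
  have "(of_nat CARD('m) * pencil Q z $ i $ j)\<^sup>2 \<le> pencil Q z $ i $ i * pencil Q z $ j $ j"
    if ij: "(i, j) \<in> \<Sigma>" for i j
  proof -
    have neq: "i \<noteq> j" using ij \<Sigma> by auto
    define Si Sj where "Si = pencil Q z $ i $ i" and "Sj = pencil Q z $ j $ j"
    have S: "0 \<le> Si" "0 \<le> Sj" by (simp_all add: Si_def Sj_def diag_nonneg)
    have bound: "2 * (val (Q p $ i $ j) + X $ p) \<le>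
        trop_plus (\<lambda>k. Q k $ i $ i) X + trop_plus (\<lambda>k. Q k $ j $ j) X" for p
      by (rule order_trans[OF ereal_mult_left_mono square[OF ij]])
         (simp_all add: term_le_trop_plus[OF X_space, of "\<lambda>k. Q k $ i $ j" p])
    have fi: "trop_plus (\<lambda>k. Q k $ i $ i) X = -\<infinity> \<and> (\<forall>k\<in>K. Q k $ i $ i = 0) \<or>
      (\<exists>k\<in>K. 0 < Q k $ i $ i \<and> trop_plus (\<lambda>k. Q k $ i $ i) X = ereal (lead_exp (Q k $ i $ i) + y k) \<and>
        Q k $ i $ i * \<zeta> k \<le> 2 * Si)"
      if "Si = pencil Q z $ i $ i" for i Si
      unfolding that pencil_z by (rule form) (simp_all add: diag E_entry)
    have "(of_nat (card K * CARD('m)) * (Q p $ i $ j * \<zeta> p))\<^sup>2 \<le> Si * Sj" if p: "p \<in> K" for p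
    proof (cases "Q p $ i $ j = 0")
      case True
      then show ?thesis using S by simp
    next
      case False
      have val_p: "2 * (val (Q p $ i $ j) + X $ p) = ereal (2 * (lead_exp (Q p $ i $ j) + y p))"
        using False Xy[OF p] by (simp add: val_nonzero)
      have finite_summands: "u \<noteq> -\<infinity> \<and> v \<noteq> -\<infinity>" if "ereal r \<le> u + v" "u \<noteq> \<infinity>" "v \<noteq> \<infinity>" for r u v
        using that by (cases u; cases v) auto
      have "trop_plus (\<lambda>k. Q k $ i $ i) X \<noteq> -\<infinity>" "trop_plus (\<lambda>k. Q k $ j $ j) X \<noteq> -\<infinity>"
        using finite_summands[OF bound[of p, unfolded val_p]] by (simp_all add: trop_plus_neq_PInf[OF X_space])
      then obtain k l where
        k: "k \<in> K" "0 < Q k $ i $ i" "trop_plus (\<lambda>k. Q k $ i $ i) X = ereal (lead_exp (Q k $ i $ i) + y k)"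
          "Q k $ i $ i * \<zeta> k \<le> 2 * Si" and
        l: "l \<in> K" "0 < Q l $ j $ j" "trop_plus (\<lambda>k. Q k $ j $ j) X = ereal (lead_exp (Q l $ j $ j) + y l)"
          "Q l $ j $ j * \<zeta> l \<le> 2 * Sj"
        using fi[OF Si_def] fi[OF Sj_def] by blast
      define h where "h = \<bar>Q p $ i $ j\<bar>"
      have h: "h \<in> E" "lead_exp h = lead_exp (Q p $ i $ j)" "h\<^sup>2 = (Q p $ i $ j)\<^sup>2"
        using False E_entry[of p i j] by (auto simp: h_def abs_if lead_exp_uminus)
      have ge: "0 \<le> c (Q k $ i $ i) (Q l $ j $ j) h + comparison (k, l, p) y"
        using bound[of p] unfolding val_p k(3) l(3) by (simp add: c_def comparison_def h(2))
      have "c (Q k $ i $ i) (Q l $ j $ j) h + comparison (k, l, p) y \<noteq> 0"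
      proof (cases "k = p \<and> l = p")
        case True
        then have "lead_exp (Q p $ i $ i) + lead_exp (Q p $ j $ j) \<noteq> 2 * lead_exp (Q p $ i $ j)"
          using generic[OF neq, of p] k(2) l(2) False by (simp add: val_nonzero)
        then show ?thesis using True by (simp add: c_def comparison_def h(2))
      next
        case False
        then show ?thesis using k(1,2) l(1,2) p h(1) E_entry by (intro gen_c) auto
      qed
      then have le: "(of_nat N * (h * \<zeta> p))\<^sup>2 \<le> (Q k $ i $ i * \<zeta> k) * (Q l $ j $ j * \<zeta> l)"
        using k(1,2) l(1,2) p h(1) E_entry ge by (intro dom) auto
      have "4 * (of_nat (card K * CARD('m)) * (Q p $ i $ j * \<zeta> p))\<^sup>2 = (of_nat N * (h * \<zeta> p))\<^sup>2"
        by (simp add: N_def power_mult_distrib h(3))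
      also note le
      also have "(Q k $ i $ i * \<zeta> k) * (Q l $ j $ j * \<zeta> l) \<le> (2 * Si) * (2 * Sj)"
        using k(2,4) l(2,4) \<zeta>(1)[of k] \<zeta>(1)[of l] S by (intro mult_mono[OF k(4) l(4)]) simp_all
      finally show ?thesis by simp
    qed
    then show ?thesis
      unfolding pencil_z[of i j] Si_def[symmetric] Sj_def[symmetric]
      using S by (intro square_sum_le_if_squares_le) auto
  qed
  moreover have "if \<sigma> p then 0 \<le> pencil Q z $ fst p $ snd p else pencil Q z $ fst p $ snd p \<le> 0"
    if p: "p \<in> pairs_compl \<Sigma>" for p
  proof -
    obtain i j where ij: "p = (i, j)" by (cases p)
    show ?thesis
    proof (cases "\<sigma> p")
      case True
      then have "trop_plus (\<lambda>k. - Q k $ i $ j) X \<le> trop_plus (\<lambda>k. Q k $ i $ j) X"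
        using sign[of i j] p by (simp add: ij sign_relation_def)
      then have "0 \<le> (\<Sum>l\<in>K. Q l $ i $ j * \<zeta> l)"
        by (intro nonneg) (simp_all add: E_entry)
      then show ?thesis using True by (simp add: ij pencil_z)
    next
      case False
      then have "trop_plus (\<lambda>k. - (- Q k $ i $ j)) X \<le> trop_plus (\<lambda>k. - Q k $ i $ j) X"
        using sign[of i j] p by (simp add: ij sign_relation_def)
      then have "0 \<le> (\<Sum>l\<in>K. - Q l $ i $ j * \<zeta> l)"
        by (intro nonneg) (simp_all add: E_entry)
      then show ?thesis using False by (simp add: ij pencil_z sum_negf)
    qed
  qed
  moreover have "0 \<le> z $ k" for k using \<zeta>(1)[of k] by (simp add: z_def)
  moreover have "val_vec z = x"
  proof -
    have "val (z $ k) = x $ k" for k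
      using xr[of k] \<zeta>(2)[of k] K(1) by (cases "k \<in> K") (auto simp: z_def)
    then show ?thesis by (simp add: val_vec_def vec_eq_iff)
  qed
  ultimately show ?thesis using diag_nonneg by blast
qed

section \<open>The image of the spectrahedron under the valuation\<close>

lemma val_vec_spectrahedron_subset: "val_vec ` spectrahedron Q \<subseteq> formal_set Q"
proof
  fix x assume "x \<in> val_vec ` spectrahedron Q"
  then obtain z where x: "x = val_vec z" and z: "\<And>k. 0 \<le> z $ k" and psd: "psd (pencil Q z)"
    by (auto simp: spectrahedron_def)
  have "ftrop_minus (entry_poly Q i i) x \<le> ftrop_plus (entry_poly Q i i) x" for i
    unfolding x using z psd_diagonal_nonneg[OF psd]
    by (intro ftrop_minus_le_plus_if_eval_nonneg) (simp_all add: mpoly_eval_entry)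
  moreover have "ftrop_minus (minor_poly Q i j) x \<le> ftrop_plus (minor_poly Q i j) x" if "i \<noteq> j" for i j
    unfolding x using z psd_minor_nonneg[OF psd that]
    by (intro ftrop_minus_le_plus_if_eval_nonneg) (simp_all add: mpoly_eval_minor)
  moreover have "x \<in> trop_space" by (simp add: x trop_space_def val_vec_def)
  ultimately show "x \<in> formal_set Q" by (simp add: formal_set_def)
qed

text \<open>
  A convex combination of nonnegative elements lies between them, and the valuation is monotone on
  nonnegative elements.
\<close>

lemma val_convex_combination:
  assumes ab: "0 \<le> a" "0 \<le> b" "a + b = 1" and xy: "0 \<le> x" "0 \<le> y" and v: "val x = v" "val y = v"
  shows "val (a * x + b * y) = v"
proof -
  have "val (a * s + b * t) = v" if st: "s \<le> t" "0 \<le> s" "val s = v" "val t = v"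
      and ab: "0 \<le> a" "0 \<le> b" "a + b = 1" for s t a b
  proof (rule antisym)
    have one: "a * r + b * r = r" for r using ab(3) by (simp flip: distrib_right)
    have "a * s + b * t \<le> a * t + b * t" using st ab by (simp add: mult_left_mono)
    then have le: "a * s + b * t \<le> t" by (simp only: one)
    have "a * s + b * s \<le> a * s + b * t" using st ab by (simp add: mult_left_mono)
    then have ge: "s \<le> a * s + b * t" by (simp only: one)
    show "val (a * s + b * t) \<le> v" using val_mono[OF _ le] ge st by simp
    show "v \<le> val (a * s + b * t)" using val_mono[OF _ ge] st by simp
  qed
  from this[of x y a b] this[of y x b a] show ?thesis
    using ab xy v by (cases "x \<le> y") (simp_all add: add.commute)
qed

text \<open>
  With \<open>\<Sigma>\<close> the set of pairs for which the diagonal terms dominate at \<open>x\<close>, the point \<open>x\<close> satisfies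
  both comparisons for each remaining pair. Hence it can be lifted with all sign patterns of the
  remaining entries, and a convex combination of the lifts makes these entries zero.
\<close>

lemma ex_lift_psd:
  fixes Q :: "'n::finite \<Rightarrow> puiseux ^ 'm::{finite,linorder} ^ 'm::{finite,linorder}"
  assumes symmetric: "\<And>k. transpose (Q k) = Q k"
    and generic: "\<And>k i j. i \<noteq> j \<Longrightarrow> 0 < Q k $ i $ i \<Longrightarrow> 0 < Q k $ j $ j \<Longrightarrow>
      val (Q k $ i $ i) + val (Q k $ j $ j) \<noteq> 2 * val (Q k $ i $ j)"
    and strata: "\<And>\<Sigma> R K. \<Sigma> \<subseteq> {(i, j). i < j} \<Longrightarrow> R \<in> pairs_compl \<Sigma> \<rightarrow>\<^sub>E {(\<le>), (\<ge>)} \<Longrightarrow> K \<noteq> {} \<Longrightarrow>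
      regular_in K (stratum K (trop_region \<Sigma> R (sval_mats Q)))"
    and x: "x \<in> formal_set Q" and K: "K = {k. x $ k \<noteq> -\<infinity>}" "K \<noteq> {}"
  shows "\<exists>z\<in>spectrahedron Q. val_vec z = x"
proof -
  define tp tm where "tp i j = trop_plus (\<lambda>k. Q k $ i $ j) x" and "tm i j = trop_plus (\<lambda>k. - Q k $ i $ j) x" for i j
  have x_space: "x \<in> trop_space" using x by (simp add: formal_set_def)
  have diag: "tm i i \<le> tp i i" for i
    using x by (simp add: formal_set_def ftrop_plus_entry ftrop_minus_entry tp_def tm_def)
  have offdiag: "tp i j = tm i j \<or> 2 * max (tp i j) (tm i j) \<le> tp i i + tp j j" if "i \<noteq> j" for i j
    using x that x_space diag[of i] diag[of j] unfolding tp_def tm_def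
    by (intro offdiagonal_condition_if_minor) (auto simp: formal_set_def)
  define \<Sigma> where "\<Sigma> = {(i, j). i < j \<and> 2 * max (tp i j) (tm i j) \<le> tp i i + tp j j}"
  have \<Sigma>: "\<Sigma> \<subseteq> {(i, j). i < j}" by (auto simp: \<Sigma>_def)
  have in_region: "x \<in> sign_region Q \<Sigma> \<sigma>" for \<sigma>
  proof -
    have eq: "tp i j = tm i j" if "(i, j) \<in> pairs_compl \<Sigma>" for i j
      using that offdiag[of i j] by (auto simp: \<Sigma>_def pairs_compl_def)
    show ?thesis
      unfolding sign_region_def trop_region_def mem_Collect_eq Qplus_eq Qminus_eq
        tp_def[symmetric] tm_def[symmetric]
    proof (intro conjI allI ballI)
      show "x \<in> trop_space" by (rule x_space)
      show "tm i i \<le> tp i i" for i by (rule diag)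
    next
      fix p assume "p \<in> \<Sigma>"
      then show "case p of (i, j) \<Rightarrow> 2 * max (tp i j) (tm i j) \<le> tp i i + tp j j"
        by (simp add: \<Sigma>_def case_prod_beta)
    next
      fix p assume p: "p \<in> pairs_compl \<Sigma>"
      obtain i j where ij: "p = (i, j)" by (rule prod.exhaust)
      show "case p of (i, j) \<Rightarrow> restrict (sign_relation \<sigma>) (pairs_compl \<Sigma>) (i, j) (tp i j) (tm i j)"
        using p eq[of i j] by (simp add: ij sign_relation_def)
    qed
  qed
  define M :: puiseux where "M = of_nat CARD('m)"
  define C where "C = {z. (\<forall>k. 0 \<le> z $ k) \<and> val_vec z = x \<and> (\<forall>i. 0 \<le> pencil Q z $ i $ i) \<and>
    (\<forall>(i, j)\<in>\<Sigma>. (M * pencil Q z $ i $ j)\<^sup>2 \<le> pencil Q z $ i $ i * pencil Q z $ j $ j)}"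
  have "\<exists>z\<in>C. \<forall>p\<in>pairs_compl \<Sigma>. pencil Q z $ fst p $ snd p = 0"
  proof (rule common_zero_if_all_signs)
    fix \<sigma> :: "'m \<times> 'm \<Rightarrow> bool"
    have "restrict (sign_relation \<sigma>) (pairs_compl \<Sigma>) \<in> pairs_compl \<Sigma> \<rightarrow>\<^sub>E {(\<le>), (\<ge>)}"
      by (auto simp: sign_relation_def)
    from ex_lift_with_signs[OF generic \<Sigma> K in_region strata[OF \<Sigma> this K(2), folded sign_region_def]]
    show "\<exists>z\<in>C. \<forall>p\<in>pairs_compl \<Sigma>. if \<sigma> p then 0 \<le> pencil Q z $ fst p $ snd p
        else pencil Q z $ fst p $ snd p \<le> 0"
      unfolding C_def M_def by blast
  next
    fix a b :: puiseux and y z :: "puiseux ^ 'n"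
    assume y: "y \<in> C" and z: "z \<in> C" and ab: "0 \<le> a" "0 \<le> b" "a + b = 1"
    let ?w = "a *s y + b *s z"
    have "(M * pencil Q ?w $ i $ j)\<^sup>2 \<le> pencil Q ?w $ i $ i * pencil Q ?w $ j $ j"
      if "(i, j) \<in> \<Sigma>" for i j
    proof -
      have scale: "(r * (M * pencil Q u $ i $ j))\<^sup>2 \<le> (r * pencil Q u $ i $ i) * (r * pencil Q u $ j $ j)"
        if "u \<in> C" for r u
      proof -
        have "r\<^sup>2 * (M * pencil Q u $ i $ j)\<^sup>2 \<le> r\<^sup>2 * (pencil Q u $ i $ i * pencil Q u $ j $ j)"
          using that \<open>(i, j) \<in> \<Sigma>\<close> by (intro mult_left_mono) (auto simp: C_def)
        then show ?thesis by (simp add: power_mult_distrib) (simp add: power2_eq_square mult_ac)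
      qed
      have nn: "0 \<le> pencil Q y $ i $ i" "0 \<le> pencil Q z $ i $ i" for i
        using y z by (simp_all add: C_def)
      have "(a * (M * pencil Q y $ i $ j) + b * (M * pencil Q z $ i $ j))\<^sup>2 \<le>
          (a * pencil Q y $ i $ i + b * pencil Q z $ i $ i) * (a * pencil Q y $ j $ j + b * pencil Q z $ j $ j)"
        using ab nn scale[OF y, of a] scale[OF z, of b] by (intro square_le_prod_add) simp_all
      then show ?thesis by (simp add: pencil_linear algebra_simps)
    qed
    moreover have "val_vec ?w = x"
    proof -
      have val: "val (u $ k) = x $ k" if "u \<in> C" for u k
      proof -
        have "val_vec u = x" using that by (simp add: C_def)
        then show ?thesis by (auto simp: val_vec_def)
      qed
      have nn: "0 \<le> y $ k" "0 \<le> z $ k" for k using y z by (simp_all add: C_def)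
      have "val (a * y $ k + b * z $ k) = x $ k" for k
        using ab nn val[OF y] val[OF z] by (rule val_convex_combination)
      then show ?thesis by (simp add: val_vec_def vec_eq_iff)
    qed
    ultimately show "?w \<in> C" using y z ab by (auto simp: C_def pencil_linear)
  qed (simp_all add: pencil_linear)
  then obtain z where z: "z \<in> C" and zero: "\<And>p. p \<in> pairs_compl \<Sigma> \<Longrightarrow> pencil Q z $ fst p $ snd p = 0"
    by blast
  have Q_sym: "Q k $ i $ j = Q k $ j $ i" for k i j
  proof -
    have "transpose (Q k) $ j $ i = Q k $ i $ j" by (simp add: transpose_def)
    then show ?thesis by (simp only: symmetric)
  qed
  have sym: "pencil Q z $ i $ j = pencil Q z $ j $ i" for i j
    by (simp add: pencil_def Q_sym[of _ i j])
  have dom: "(M * pencil Q z $ i $ j)\<^sup>2 \<le> pencil Q z $ i $ i * pencil Q z $ j $ j" if "i < j" for i j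
  proof (cases "(i, j) \<in> \<Sigma>")
    case True
    then show ?thesis using z by (auto simp: C_def)
  next
    case False
    then have "pencil Q z $ i $ j = 0" using zero[of "(i, j)"] that by (simp add: pairs_compl_def)
    then show ?thesis using z by (simp add: C_def)
  qed
  have "psd (pencil Q z)"
  proof (rule psd_if_diagonally_dominant)
    show "transpose (pencil Q z) = pencil Q z"
      unfolding transpose_def vec_eq_iff by (simp add: sym)
    show "0 \<le> pencil Q z $ i $ i" for i using z by (simp add: C_def)
    show "(of_nat CARD('m) * pencil Q z $ i $ j)\<^sup>2 \<le> pencil Q z $ i $ i * pencil Q z $ j $ j" if "i \<noteq> j" for i j
      using that dom[of i j] dom[of j i] sym[of i j] unfolding M_def by (cases "i < j") (auto simp: mult.commute)
  qed
  then have "z \<in> spectrahedron Q" using z by (simp add: C_def spectrahedron_def)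
  then show ?thesis using z by (auto simp: C_def)
qed

theorem theorem5p18:
  fixes Q :: "'n::finite \<Rightarrow> puiseux ^ 'm::{finite,linorder} ^ 'm::{finite,linorder}"
  assumes symmetric: "\<And>k. transpose (Q k) = Q k"
    and generic: "\<And>k i j. i \<noteq> j \<Longrightarrow> sval_mats Q k $ i $ i \<in> trop_pos \<Longrightarrow> sval_mats Q k $ j $ j \<in> trop_pos \<Longrightarrow>
      modulus (sval_mats Q k $ i $ i) + modulus (sval_mats Q k $ j $ j) \<noteq> 2 * modulus (sval_mats Q k $ i $ j)"
    and strata: "\<And>\<Sigma> R K. \<Sigma> \<subseteq> {(i, j). i < j} \<Longrightarrow> R \<in> pairs_compl \<Sigma> \<rightarrow>\<^sub>E {(\<le>), (\<ge>)} \<Longrightarrow> K \<noteq> {} \<Longrightarrow>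
      regular_in K (stratum K (trop_region \<Sigma> R (sval_mats Q)))"
  shows "val_vec ` spectrahedron Q = formal_set Q"
proof
  show "val_vec ` spectrahedron Q \<subseteq> formal_set Q" by (rule val_vec_spectrahedron_subset)
  show "formal_set Q \<subseteq> val_vec ` spectrahedron Q"
  proof
    fix x assume x: "x \<in> formal_set Q"
    have gen: "val (Q k $ i $ i) + val (Q k $ j $ j) \<noteq> 2 * val (Q k $ i $ j)"
      if "i \<noteq> j" "0 < Q k $ i $ i" "0 < Q k $ j $ j" for k i j
      using generic[OF that(1), of k] that(2,3)
      by (simp add: sval_mats_entry sval_in_trop_pos_iff modulus_sval)
    have "\<exists>z\<in>spectrahedron Q. val_vec z = x"
    proof (cases "{k. x $ k \<noteq> -\<infinity>} = {}")
      case False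
      then show ?thesis by (intro ex_lift_psd[OF symmetric gen strata x refl])
    next
      \<comment> \<open>the point without finite coordinates belongs to no stratum; its lift is \<open>0\<close>\<close>
      case True
      have "pencil Q 0 = 0" by (simp add: pencil_def vec_eq_iff)
      then have "0 \<in> spectrahedron Q"
        by (simp add: spectrahedron_def psd_def transpose_def vec_eq_iff matrix_vector_mult_def)
      moreover have "val_vec 0 = x" using True by (simp add: val_vec_def vec_eq_iff)
      ultimately show ?thesis by blast
    qed
    then show "x \<in> val_vec ` spectrahedron Q" by blast
  qed
qed

end
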